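(* Let $u:\mathbb{R}^2\to\mathbb{R}$ be a smooth solution of $-\Delta u = x_1e^{u}$ in $\mathbb{R}^2$ such that $u(x)\le u(0)=0$ on $\mathbb{R}^2$, $\int_{\mathbb{R}^2}|x_1|e^{u}\,dx<\infty$ and $\int_{\mathbb{R}^2}x_1e^{u}\,dx>0$. Let $v=v_0-v_1$ be as defined in the context. Then $u+v$ is constant on $\mathbb{R}^2$.
   Context: Write $K(x)=x_1$, $K_+(x)=\max(x_1,0)$, $K_-(x)=\max(-x_1,0)$. Define $$v_0(x)=\frac{1}{2\pi}\int_{\mathbb{R}^2}\log\frac{|x-y|}{|y|}\,K_+(y)e^{u(y)}\,dy,\qquad v_1(x)=\frac{1}{2\pi}\int_{\mathbb{R}^2}\log\frac{|x-y|}{|y|}\,K_-(y)e^{u(y)}\,dy,$$ and $v=v_0-v_1$. *)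

theory Defs
  imports "HOL-Analysis.Analysis"
begin

text \<open>Points of the plane are pairs (x1, x2) :: real \<times> real; the norm on this
product type is the Euclidean norm.\<close>

definition pd :: "nat \<Rightarrow> (real \<times> real \<Rightarrow> real) \<Rightarrow> real \<times> real \<Rightarrow> real" where
  "pd i f = (\<lambda>(a, b). if i = 1 then deriv (\<lambda>t. f (t, b)) a else deriv (\<lambda>t. f (a, t)) b)"

fun dop :: "nat list \<Rightarrow> (real \<times> real \<Rightarrow> real) \<Rightarrow> real \<times> real \<Rightarrow> real" where
  "dop [] f = f"
| "dop (i # is) f = pd i (dop is f)"

definition smooth2 :: "(real \<times> real \<Rightarrow> real) \<Rightarrow> bool" where
  "smooth2 f \<longleftrightarrow> (\<forall>is. set is \<subseteq> {1, 2} \<longrightarrow> dop is f differentiable_on UNIV)"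

definition laplacian :: "(real \<times> real \<Rightarrow> real) \<Rightarrow> real \<times> real \<Rightarrow> real" where
  "laplacian f x = pd 1 (pd 1 f) x + pd 2 (pd 2 f) x"

definition Kp :: "real \<times> real \<Rightarrow> real" where "Kp y = max (fst y) 0"
definition Km :: "real \<times> real \<Rightarrow> real" where "Km y = max (- fst y) 0"

definition v0 :: "(real \<times> real \<Rightarrow> real) \<Rightarrow> real \<times> real \<Rightarrow> real" where
  "v0 u x = 1 / (2 * pi) * (\<integral>y. ln (norm (x - y) / norm y) * Kp y * exp (u y) \<partial>lborel)"

definition v1 :: "(real \<times> real \<Rightarrow> real) \<Rightarrow> real \<times> real \<Rightarrow> real" where
  "v1 u x = 1 / (2 * pi) * (\<integral>y. ln (norm (x - y) / norm y) * Km y * exp (u y) \<partial>lborel)"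

definition vfun :: "(real \<times> real \<Rightarrow> real) \<Rightarrow> real \<times> real \<Rightarrow> real" where
  "vfun u x = v0 u x - v1 u x"

end

theory Submission
  imports Defs "HOL-Complex_Analysis.Cauchy_Integral_Formula" "HOL-Real_Asymp.Real_Asymp"
begin

text \<open>The function h = u + v has the mean value property on discs, and h grows at most
logarithmically from above; a Liouville argument then makes it constant.

The mean value property needs no regularity of v. In polar coordinates, Jensen's formula gives
the disc average of u around a as u(a) plus the integral of a kernel k against the Laplacian of u.
The disc average of ln|x - y| in x is explicit (Cauchy's formula on circles), and it
equals ln|a - y| plus a multiple of the same kernel; by Fubini the average of v is therefore v(a)
plus the integral of k against x1 exp u. The two kernel terms cancel.

Since u is at most 0, the density f = x1 exp u satisfies |f(y)| \<le> |y|. This controls both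
singularities of ln(|x - y| / |y|) and yields |v(x)| = O(ln(1 + |x|)).\<close>

section \<open>Polar coordinates\<close>

text \<open>The kernel k(s) = ln(R/s) + (s^2/R^2 - 1)/2 is the radial function on the disc of radius
  R that has Laplacian 2/R^2 - 2 pi delta and vanishes together with its derivative at s = R.
  Green's identity on the disc therefore has no boundary terms: it trades the integral of k times
  the Laplacian of u for the integral of u and the value of u at the centre. The same k is the
  excess of the disc average of the logarithm over its value at the centre, which is why u and v
  produce matching terms.

  Discs are preferred to circles because Fubini's theorem then runs over Lebesgue measure on the
  plane, and the circle through the logarithmic singularity is a single negligible radius.

  Polar coordinates are built from one-dimensional substitutions only: the plane is swept by the
  lines y = x t through the origin, and then t = tan theta.\<close>

lemma nn_integral_tan_substitution:
  fixes H :: "real \<Rightarrow> ennreal"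
  assumes [measurable]: "H \<in> borel_measurable borel"
  shows "(\<integral>\<^sup>+t. H t \<partial>lborel) =
    (\<integral>\<^sup>+\<theta>. H (tan \<theta>) * ennreal (inverse ((cos \<theta>)\<^sup>2)) * indicator {-pi/2<..<pi/2} \<theta> \<partial>lborel)"
proof -
  \<comment> \<open>Substitution is applied on compact intervals, where \<open>tan\<close> is
    smooth. The intervals [-(n+1), n+1] and their preimages [-a n, a n] exhaust the line and the
    open angle range, and monotone convergence passes to the limit.\<close>
  define a where "a n = arctan (real (Suc n))" for n
  have a: "0 < a n" "a n < pi/2" "tan (a n) = real (Suc n)" for n
    unfolding a_def using arctan_bounded[of "real (Suc n)"] zero_less_arctan_iff[of "real (Suc n)"]
    by (auto simp: tan_arctan simp del: of_nat_Suc)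
  have inca: "incseq a"
    by (auto simp: incseq_def a_def arctan_le_iff)
  have tana: "tan (- a n) = - real (Suc n)" for n using a(3)[of n] by simp
  let ?G = "\<lambda>\<theta>. H (tan \<theta>) * ennreal (inverse ((cos \<theta>)\<^sup>2))"
  have [measurable]: "(\<lambda>x::real. tan x) \<in> borel_measurable borel"
    unfolding tan_def by measurable
  have cosp: "cos x \<noteq> 0" if "x \<in> {- a n..a n}" for x n
    using that a[of n] cos_gt_zero_pi[of x] by auto
  have eq: "(\<integral>\<^sup>+t. H t * indicator {-real (Suc n)..real (Suc n)} t \<partial>lborel) =
     (\<integral>\<^sup>+\<theta>. ?G \<theta> * indicator {- a n..a n} \<theta> \<partial>lborel)" for n
  proof -
    have c: "continuous_on {- a n..a n} (\<lambda>x. inverse ((cos x)\<^sup>2))"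
      by (intro continuous_intros) (use cosp in auto)
    show ?thesis
      using nn_integral_substitution_aux[of H "- a n" "a n" tan "\<lambda>x. inverse ((cos x)\<^sup>2)", OF _ _ _ c]
        a[of n] unfolding tana a(3) by (auto intro!: DERIV_tan simp: cosp simp del: of_nat_Suc)
  qed
  have "(\<integral>\<^sup>+t. H t \<partial>lborel) = (\<integral>\<^sup>+t. (SUP n. H t * indicator {-real (Suc n)..real (Suc n)} t) \<partial>lborel)"
  proof (rule nn_integral_cong)
    fix t :: real
    obtain n where "\<bar>t\<bar> \<le> real n" using real_arch_simple by blast
    then have "H t * indicator {-real (Suc n)..real (Suc n)} t = H t" by (auto simp: indicator_def)
    then show "H t = (SUP n. H t * indicator {-real (Suc n)..real (Suc n)} t)"
      by (intro antisym SUP_least) (auto intro: SUP_upper2[of n] simp: indicator_def)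
  qed
  also have "\<dots> = (SUP n. \<integral>\<^sup>+t. H t * indicator {-real (Suc n)..real (Suc n)} t \<partial>lborel)"
    by (intro nn_integral_monotone_convergence_SUP)
       (auto simp: incseq_def le_fun_def intro!: mult_left_mono split: split_indicator)
  also have "\<dots> = (SUP n. \<integral>\<^sup>+\<theta>. ?G \<theta> * indicator {- a n..a n} \<theta> \<partial>lborel)"
    by (simp only: eq)
  also have "\<dots> = (\<integral>\<^sup>+\<theta>. (SUP n. ?G \<theta> * indicator {- a n..a n} \<theta>) \<partial>lborel)"
  proof (rule nn_integral_monotone_convergence_SUP[symmetric])
    show "incseq (\<lambda>n \<theta>. ?G \<theta> * indicator {- a n..a n} \<theta>)"
      using inca by (auto simp: incseq_def le_fun_def intro!: mult_left_mono split: split_indicator)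
        (meson order_trans neg_le_iff_le)+
  qed auto
  also have "\<dots> = (\<integral>\<^sup>+\<theta>. ?G \<theta> * indicator {-pi/2<..<pi/2} \<theta> \<partial>lborel)"
  proof (rule nn_integral_cong)
    fix \<theta> :: real
    show "(SUP n. ?G \<theta> * indicator {- a n..a n} \<theta>) = ?G \<theta> * indicator {-pi/2<..<pi/2} \<theta>"
    proof (cases "\<theta> \<in> {-pi/2<..<pi/2}")
      case True
      obtain n where n: "\<bar>tan \<theta>\<bar> \<le> real n" using real_arch_simple by blast
      have "arctan (tan \<theta>) = \<theta>" using True by (simp add: arctan_tan)
      moreover have "arctan (tan \<theta>) \<le> a n" "arctan (tan \<theta>) \<ge> arctan (- real (Suc n))"
        using n unfolding a_def arctan_le_iff by auto
      ultimately have "\<theta> \<in> {- a n..a n}" by (auto simp: a_def arctan_minus simp del: of_nat_Suc)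
      then have "?G \<theta> * indicator {- a n..a n} \<theta> = ?G \<theta>" by simp
      with True show ?thesis
        by (intro antisym SUP_least) (auto intro: SUP_upper2[of n] simp: indicator_def)
    next
      case False
      then have "\<theta> \<notin> {- a n..a n}" for n using a[of n] by auto
      with False show ?thesis by simp
    qed
  qed
  finally show ?thesis .
qed

text \<open>The slope substitution y = x t has Jacobian |x|. With t = tan theta and x = r cos theta,
  the factor cos^2 theta from |x| dx cancels the 1 / cos^2 theta from dt. Here r runs over the whole
  line, so half a turn of angles covers the plane and the weight is |r|.\<close>

lemma nn_integral_polar_aux:
  fixes g :: "real \<times> real \<Rightarrow> ennreal"
  assumes [measurable]: "g \<in> borel_measurable borel"
  shows "(\<integral>\<^sup>+z. g z \<partial>lborel) =
    (\<integral>\<^sup>+\<theta>. (\<integral>\<^sup>+r. ennreal \<bar>r\<bar> * g (r * cos \<theta>, r * sin \<theta>) \<partial>lborel) * indicator {-pi/2<..<pi/2} \<theta> \<partial>lborel)"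
proof -
  have [measurable]: "(\<lambda>x. g (h x, k x)) \<in> borel_measurable M"
    if [measurable]: "h \<in> borel_measurable M" "k \<in> borel_measurable M" for M and h k :: "_ \<Rightarrow> real"
    by (rule measurable_compose[OF _ assms]) measurable
  have inner: "(\<integral>\<^sup>+x. ennreal \<bar>x\<bar> * g (x, x * tan \<theta>) \<partial>lborel) * ennreal (inverse ((cos \<theta>)\<^sup>2)) =
      (\<integral>\<^sup>+r. ennreal \<bar>r\<bar> * g (r * cos \<theta>, r * sin \<theta>) \<partial>lborel)" if "\<theta> \<in> {-pi/2<..<pi/2}" for \<theta>
  proof -
    have c: "cos \<theta> > 0" using that cos_gt_zero_pi by auto
    have "(\<integral>\<^sup>+x. ennreal \<bar>x\<bar> * g (x, x * tan \<theta>) \<partial>lborel) =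
       ennreal (cos \<theta>) * (\<integral>\<^sup>+r. ennreal \<bar>cos \<theta> * r\<bar> * g (cos \<theta> * r, cos \<theta> * r * tan \<theta>) \<partial>lborel)"
      using c by (subst nn_integral_real_affine[where c="cos \<theta>" and t=0]) simp_all
    also have "(\<integral>\<^sup>+r. ennreal \<bar>cos \<theta> * r\<bar> * g (cos \<theta> * r, cos \<theta> * r * tan \<theta>) \<partial>lborel) =
       (\<integral>\<^sup>+r. ennreal (cos \<theta>) * (ennreal \<bar>r\<bar> * g (r * cos \<theta>, r * sin \<theta>)) \<partial>lborel)"
      using c by (intro nn_integral_cong) (simp add: abs_mult ennreal_mult tan_def mult_ac)
    also have "\<dots> = ennreal (cos \<theta>) * (\<integral>\<^sup>+r. ennreal \<bar>r\<bar> * g (r * cos \<theta>, r * sin \<theta>) \<partial>lborel)"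
      by (rule nn_integral_cmult) measurable
    finally have *: "(\<integral>\<^sup>+x. ennreal \<bar>x\<bar> * g (x, x * tan \<theta>) \<partial>lborel) = ennreal (cos \<theta>) * (ennreal (cos \<theta>) *
       (\<integral>\<^sup>+r. ennreal \<bar>r\<bar> * g (r * cos \<theta>, r * sin \<theta>) \<partial>lborel))" .
    have "ennreal (cos \<theta>) * ennreal (cos \<theta>) * ennreal (inverse ((cos \<theta>)\<^sup>2)) = 1"
      using c by (simp flip: ennreal_mult add: power2_eq_square field_simps)
    then show ?thesis unfolding *
      by (metis (no_types, lifting) mult.assoc mult.commute mult.right_neutral)
  qed
  have "(\<integral>\<^sup>+z. g z \<partial>lborel) = (\<integral>\<^sup>+x. \<integral>\<^sup>+y. g (x, y) \<partial>lborel \<partial>lborel)"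
    unfolding lborel_prod[symmetric] by (rule lborel.nn_integral_fst[symmetric]) (simp add: lborel_prod assms)
  also have "\<dots> = (\<integral>\<^sup>+x. \<integral>\<^sup>+t. ennreal \<bar>x\<bar> * g (x, x * t) \<partial>lborel \<partial>lborel)"
  proof (rule nn_integral_cong_AE, rule AE_I[where N="{0}"])
    show "{x \<in> space lborel. \<not> (\<integral>\<^sup>+y. g (x, y) \<partial>lborel) = (\<integral>\<^sup>+t. ennreal \<bar>x\<bar> * g (x, x * t) \<partial>lborel)} \<subseteq> {0}"
    proof safe
      fix x :: real assume ne: "(\<integral>\<^sup>+y. g (x, y) \<partial>lborel) \<noteq> (\<integral>\<^sup>+t. ennreal \<bar>x\<bar> * g (x, x * t) \<partial>lborel)"
      have "(\<integral>\<^sup>+y. g (x, y) \<partial>lborel) = (\<integral>\<^sup>+t. ennreal \<bar>x\<bar> * g (x, x * t) \<partial>lborel)" if "x \<noteq> 0"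
        using that by (subst nn_integral_real_affine[where c=x and t=0]) (simp_all add: nn_integral_cmult)
      with ne show "x = 0" by blast
    qed
  qed auto
  also have "\<dots> = (\<integral>\<^sup>+t. \<integral>\<^sup>+x. ennreal \<bar>x\<bar> * g (x, x * t) \<partial>lborel \<partial>lborel)"
    by (rule lborel_pair.Fubini'[symmetric]) measurable
  also have "\<dots> = (\<integral>\<^sup>+\<theta>. (\<integral>\<^sup>+x. ennreal \<bar>x\<bar> * g (x, x * tan \<theta>) \<partial>lborel) * ennreal (inverse ((cos \<theta>)\<^sup>2)) *
       indicator {-pi/2<..<pi/2} \<theta> \<partial>lborel)"
    by (rule nn_integral_tan_substitution) measurable
  also have "\<dots> = (\<integral>\<^sup>+\<theta>. (\<integral>\<^sup>+r. ennreal \<bar>r\<bar> * g (r * cos \<theta>, r * sin \<theta>) \<partial>lborel) *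
       indicator {-pi/2<..<pi/2} \<theta> \<partial>lborel)"
    by (intro nn_integral_cong) (auto simp: inner split: split_indicator)
  finally show ?thesis .
qed

text \<open>The angle runs over [-pi/2, 3 pi/2] because the substitution y = x tan t produces the
half-planes x > 0 and x < 0 separately.\<close>

lemma nn_integral_polar:
  fixes g :: "real \<times> real \<Rightarrow> ennreal"
  assumes [measurable]: "g \<in> borel_measurable borel"
  shows "(\<integral>\<^sup>+z. g z \<partial>lborel) =
    (\<integral>\<^sup>+r. \<integral>\<^sup>+\<theta>. ennreal (r * indicator {0<..} r * indicator {-pi/2..3*pi/2} \<theta>) * g (r * cos \<theta>, r * sin \<theta>)
       \<partial>lborel \<partial>lborel)"
proof -
  have [measurable]: "(\<lambda>x. g (h x, k x)) \<in> borel_measurable M"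
    if [measurable]: "h \<in> borel_measurable M" "k \<in> borel_measurable M" for M and h k :: "_ \<Rightarrow> real"
    by (rule measurable_compose[OF _ assms]) measurable
  \<comment> \<open>\<open>N\<close> integrates along the open ray at angle theta; the opposite ray,
    which is the part r < 0 of the line, is \<open>N (\<theta> + pi)\<close>.\<close>
  define N where "N \<theta> = (\<integral>\<^sup>+r. ennreal (r * indicator {0<..} r) * g (r * cos \<theta>, r * sin \<theta>) \<partial>lborel)" for \<theta>
  have [measurable]: "N \<in> borel_measurable borel"
    unfolding N_def by measurable
  have split: "(\<integral>\<^sup>+r. ennreal \<bar>r\<bar> * g (r * cos \<theta>, r * sin \<theta>) \<partial>lborel) = N \<theta> + N (\<theta> + pi)" for \<theta>
  proof -
    have "N (\<theta> + pi) = (\<integral>\<^sup>+r. ennreal (- r * indicator {..<0} r) * g (r * cos \<theta>, r * sin \<theta>) \<partial>lborel)"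
      unfolding N_def
      by (subst nn_integral_real_affine[where c="-1" and t=0])
        (auto intro!: nn_integral_cong split: split_indicator)
    then have "N \<theta> + N (\<theta> + pi) = (\<integral>\<^sup>+r. ennreal (r * indicator {0<..} r) * g (r * cos \<theta>, r * sin \<theta>)
       + ennreal (- r * indicator {..<0} r) * g (r * cos \<theta>, r * sin \<theta>) \<partial>lborel)"
      by (simp add: N_def nn_integral_add)
    also have "\<dots> = (\<integral>\<^sup>+r. ennreal \<bar>r\<bar> * g (r * cos \<theta>, r * sin \<theta>) \<partial>lborel)"
      by (intro nn_integral_cong) (auto split: split_indicator)
    finally show ?thesis by simp
  qed
  have "(\<integral>\<^sup>+z. g z \<partial>lborel) = (\<integral>\<^sup>+\<theta>. (N \<theta> + N (\<theta> + pi)) * indicator {-pi/2<..<pi/2} \<theta> \<partial>lborel)"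
    by (subst nn_integral_polar_aux) (simp_all add: split)
  also have "\<dots> = (\<integral>\<^sup>+\<theta>. N \<theta> * indicator {-pi/2<..<pi/2} \<theta> \<partial>lborel) +
      (\<integral>\<^sup>+\<theta>. N (\<theta> + pi) * indicator {-pi/2<..<pi/2} \<theta> \<partial>lborel)"
    by (subst nn_integral_add[symmetric]) (auto simp: distrib_right)
  also have "(\<integral>\<^sup>+\<theta>. N (\<theta> + pi) * indicator {-pi/2<..<pi/2} \<theta> \<partial>lborel) =
      (\<integral>\<^sup>+\<theta>. N \<theta> * indicator {pi/2<..<3*pi/2} \<theta> \<partial>lborel)"
    by (subst nn_integral_real_affine[where c=1 and t="-pi"])
       (auto intro!: nn_integral_cong split: split_indicator)
  also have "(\<integral>\<^sup>+\<theta>. N \<theta> * indicator {-pi/2<..<pi/2} \<theta> \<partial>lborel) +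
      (\<integral>\<^sup>+\<theta>. N \<theta> * indicator {pi/2<..<3*pi/2} \<theta> \<partial>lborel) =
      (\<integral>\<^sup>+\<theta>. N \<theta> * (indicator {-pi/2<..<pi/2} \<theta> + indicator {pi/2<..<3*pi/2} \<theta>) \<partial>lborel)"
    by (subst nn_integral_add[symmetric]) (auto simp: distrib_left)
  also have "\<dots> = (\<integral>\<^sup>+\<theta>. N \<theta> * indicator {-pi/2..3*pi/2} \<theta> \<partial>lborel)"
  proof (rule nn_integral_cong_AE, rule AE_I[where N="{-pi/2, pi/2, 3*pi/2}"])
    show "emeasure lborel {-pi/2, pi/2, 3*pi/2} = 0"
      by (rule emeasure_lborel_countable) simp
  qed (auto split: split_indicator)
  also have "\<dots> = (\<integral>\<^sup>+\<theta>. \<integral>\<^sup>+r. ennreal (r * indicator {0<..} r * indicator {-pi/2..3*pi/2} \<theta>) *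
      g (r * cos \<theta>, r * sin \<theta>) \<partial>lborel \<partial>lborel)"
    unfolding N_def
    by (subst nn_integral_multc[symmetric]) (auto intro!: nn_integral_cong split: split_indicator)
  also have "\<dots> = (\<integral>\<^sup>+r. \<integral>\<^sup>+\<theta>. ennreal (r * indicator {0<..} r * indicator {-pi/2..3*pi/2} \<theta>) *
      g (r * cos \<theta>, r * sin \<theta>) \<partial>lborel \<partial>lborel)"
    by (rule lborel_pair.Fubini') measurable
  finally show ?thesis .
qed

definition polar :: "real \<times> real \<Rightarrow> real \<times> real" where
  "polar = (\<lambda>(r, \<theta>). (r * cos \<theta>, r * sin \<theta>))"

text \<open>The Jacobian of \<open>polar\<close>, cut off to one sheet of the parameter plane, so
  that each point is counted once up to null sets.\<close>

definition polar_density :: "real \<times> real \<Rightarrow> real" where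
  "polar_density = (\<lambda>(r, \<theta>). r * indicator {0<..} r * indicator {-pi/2..3*pi/2} \<theta>)"

lemma polar_measurable [measurable]: "polar \<in> borel_measurable borel"
  unfolding polar_def borel_prod[symmetric] by measurable

lemma polar_density_measurable [measurable]: "polar_density \<in> borel_measurable borel"
  unfolding polar_density_def borel_prod[symmetric] by measurable

lemma polar_density_nonneg: "polar_density p \<ge> 0"
  unfolding polar_density_def by (auto split: prod.split split_indicator)

text \<open>As an identity of measures, the formula for nonnegative functions extends to
  integrability and signed integrals through the general rules for \<open>distr\<close> and
  \<open>density\<close>.\<close>

lemma lborel_eq_polar:
  "(lborel :: (real \<times> real) measure) = distr (density lborel polar_density) borel polar"
proof (rule measure_eqI)
  fix A :: "(real \<times> real) set" assume "A \<in> sets lborel"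
  then have A [measurable]: "A \<in> sets borel" by simp
  have "emeasure lborel A = (\<integral>\<^sup>+z. indicator A z \<partial>lborel)" by simp
  also have "\<dots> = (\<integral>\<^sup>+r. \<integral>\<^sup>+\<theta>. ennreal (polar_density (r, \<theta>)) * indicator A (polar (r, \<theta>)) \<partial>lborel \<partial>lborel)"
    by (subst nn_integral_polar) (auto simp: polar_def polar_density_def)
  also have "\<dots> = (\<integral>\<^sup>+p. ennreal (polar_density p) * indicator A (polar p) \<partial>(lborel \<Otimes>\<^sub>M lborel))"
    by (rule lborel.nn_integral_fst) (simp add: lborel_prod)
  also have "\<dots> = emeasure (distr (density lborel polar_density) borel polar) A"
    using measurable_sets[OF polar_measurable A]
    by (simp add: lborel_prod emeasure_distr emeasure_density)
       (auto intro!: nn_integral_cong split: split_indicator)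
  finally show "emeasure lborel A = emeasure (distr (density lborel polar_density) borel polar) A" .
qed simp

lemma
  fixes g :: "real \<times> real \<Rightarrow> real"
  assumes g: "integrable lborel g"
  shows integrable_polar: "integrable (lborel \<Otimes>\<^sub>M lborel) (\<lambda>p. polar_density p * g (polar p))"
    and integral_polar: "(\<integral>z. g z \<partial>lborel) =
      (\<integral>r. \<integral>\<theta>. polar_density (r, \<theta>) * g (polar (r, \<theta>)) \<partial>lborel \<partial>lborel)"
proof -
  have [measurable]: "g \<in> borel_measurable borel" using g by auto
  have i: "integrable lborel (\<lambda>p. polar_density p * g (polar p))"
    using g unfolding lborel_eq_polar[THEN arg_cong, of "\<lambda>M. integrable M g"]
    by (simp add: integrable_distr_eq integrable_density polar_density_nonneg)
  then show "integrable (lborel \<Otimes>\<^sub>M lborel) (\<lambda>p. polar_density p * g (polar p))"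
    by (simp add: lborel_prod)
  then have "(\<integral>r. \<integral>\<theta>. polar_density (r, \<theta>) * g (polar (r, \<theta>)) \<partial>lborel \<partial>lborel) =
     (\<integral>p. polar_density p * g (polar p) \<partial>(lborel \<Otimes>\<^sub>M lborel))"
    by (rule lborel_pair.integral_fst')
  also have "\<dots> = (\<integral>z. g z \<partial>lborel)"
    unfolding lborel_eq_polar[THEN arg_cong, of "\<lambda>M. (\<integral>z. g z \<partial>M)"]
    by (simp add: integral_distr integral_density polar_density_nonneg lborel_prod)
  finally show "(\<integral>z. g z \<partial>lborel) =
      (\<integral>r. \<integral>\<theta>. polar_density (r, \<theta>) * g (polar (r, \<theta>)) \<partial>lborel \<partial>lborel)" by simp
qed

section \<open>Averages of the logarithm\<close>

text \<open>The integrand is the real part of Ln(1 - c u) on the unit circle. This function is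
  holomorphic on the closed disc, because 1 - c u has positive real part there, and Cauchy's formula
  returns its value Ln 1 = 0 at the centre.\<close>

lemma has_integral_ln_norm_one_minus_cis:
  fixes c :: complex
  assumes "norm c < 1"
  shows "((\<lambda>\<theta>. ln (norm (1 - c * cis \<theta>))) has_integral 0) {-pi/2..3*pi/2}"
proof -
  \<comment> \<open>A quarter turn moves the circle path's range [0, 2 pi] to the angle range
    [-pi/2, 3 pi/2]: \<open>c' * cis (t + pi/2) = c * cis t\<close>.\<close>
  define c' where "c' = c * (- \<i>)"
  have c': "norm c' < 1" using assms by (simp add: c'_def norm_mult)
  have pos: "Re (1 - c' * u) > 0" if "norm u \<le> 1" for u
  proof -
    have "norm (c' * u) < 1" using that c' mult_left_le[of "norm u" "norm c'"] by (simp add: norm_mult)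
    then have "\<bar>Re (c' * u)\<bar> < 1" using abs_Re_le_cmod le_less_trans by blast
    then show ?thesis by simp
  qed
  have hol: "(\<lambda>u. Ln (1 - c' * u)) holomorphic_on cball 0 1"
  proof (intro holomorphic_intros)
    fix u assume "u \<in> cball (0::complex) 1"
    then show "1 - c' * u \<notin> \<real>\<^sub>\<le>\<^sub>0" using pos[of u] complex_nonpos_Reals_iff not_le by auto
  qed
  have "((\<lambda>u. Ln (1 - c' * u) / (u - 0)) has_contour_integral (2 * of_real pi * \<i> * Ln (1 - c' * 0))) (circlepath 0 1)"
    by (rule Cauchy_integral_circlepath_simple[OF hol]) simp
  then have "((\<lambda>t. Ln (1 - c' * cis t) / cis t * \<i> * cis t) has_integral 0) {0..2*pi}"
    unfolding circlepath_def by (subst (asm) has_contour_integral_part_circlepath_iff) simp_all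
  then have "((\<lambda>t. \<i> * Ln (1 - c' * cis t)) has_integral 0) {0..2*pi}"
    by (rule has_integral_eq[rotated]) (simp add: field_simps)
  then have "((\<lambda>t. Re (- \<i> * (\<i> * Ln (1 - c' * cis t)))) has_integral Re (- \<i> * 0)) {0..2*pi}"
    by (intro has_integral_Re has_integral_mult_right)
  then have *: "((\<lambda>t. Re (Ln (1 - c' * cis t))) has_integral 0) {0..2*pi}"
    by simp
  have "((\<lambda>t. ln (norm (1 - c' * cis t))) has_integral 0) {0..2*pi}"
  proof (rule has_integral_eq[OF _ *])
    fix t :: real
    have "1 - c' * cis t \<noteq> 0" using pos[of "cis t"]
      by (metis less_irrefl norm_cis order_refl zero_complex.simps(1))
    then show "Re (Ln (1 - c' * cis t)) = ln (norm (1 - c' * cis t))" by (rule Re_Ln)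
  qed
  then have "((\<lambda>t. ln (norm (1 - c' * cis (t + pi/2)))) has_integral 0) (cbox (0 - pi/2) (2*pi - pi/2))"
    using has_integral_affinity[of "\<lambda>t. ln (norm (1 - c' * cis t))" 0 0 "2*pi" 1 "pi/2"]
    by (simp add: image_affinity_atLeastAtMost_diff)
  moreover have "c' * cis (t + pi/2) = c * cis t" for t
    by (simp add: c'_def complex_eq_iff cos_add sin_add algebra_simps)
  ultimately show ?thesis by simp
qed

text \<open>Factoring out the larger of r and |b| leaves |1 - c cis theta| with |c| < 1, whose
  logarithm integrates to zero. For |b| < r the difference is conjugated first, so that
  \<open>cis \<theta>\<close> again multiplies c. At r = |b| the factor c would have modulus
  1.\<close>

lemma has_integral_ln_norm_circle:
  fixes b :: "real \<times> real"
  assumes r: "r > 0" and b: "b \<noteq> 0" and neq: "r \<noteq> norm b"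
  shows "((\<lambda>\<theta>. ln (norm ((r * cos \<theta>, r * sin \<theta>) - b))) has_integral 2 * pi * ln (max r (norm b))) {-pi/2..3*pi/2}"
proof -
  define w where "w = Complex (fst b) (snd b)"
  have nw: "norm w = norm b" by (simp add: w_def norm_prod_def cmod_def)
  have w: "norm ((r * cos \<theta>, r * sin \<theta>) - b) = norm (of_real r * cis \<theta> - w)" for \<theta>
    by (simp add: w_def norm_prod_def cmod_def)
  define c where "c = (if norm b < r then cnj w / of_real r else of_real r / w)"
  have w0: "w \<noteq> 0" using b nw by auto
  have c: "norm c < 1" using r neq b by (simp add: c_def norm_divide nw)
  have eq: "norm (of_real r * cis \<theta> - w) = max r (norm b) * norm (1 - c * cis \<theta>)" for \<theta>
  proof (cases "norm b < r")
    case True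
    have "norm (of_real r * cis \<theta> - w) = norm (cnj (of_real r * cis \<theta> - w))" by (rule complex_mod_cnj[symmetric])
    also have "cnj (of_real r * cis \<theta> - w) = of_real r * cis (-\<theta>) * (1 - c * cis \<theta>)"
      using r True by (simp add: c_def cis_cnj algebra_simps cis_mult)
    also have "norm \<dots> = r * norm (1 - c * cis \<theta>)" using r by (simp add: norm_mult)
    finally show ?thesis using True by simp
  next
    case False
    have "of_real r * cis \<theta> - w = - w * (1 - c * cis \<theta>)"
      using w0 False by (simp add: c_def algebra_simps)
    then show ?thesis using False nw by (simp add: norm_mult)
  qed
  have ne: "norm (1 - c * cis \<theta>) \<noteq> 0" for \<theta>
  proof
    assume "norm (1 - c * cis \<theta>) = 0"
    then have "norm (c * cis \<theta>) = norm (1::complex)" by (metis eq_iff_diff_eq_0 norm_eq_zero)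
    then show False using c by (simp add: norm_mult)
  qed
  have m: "max r (norm b) > 0" using r by simp
  have "((\<lambda>\<theta>. ln (max r (norm b)) + ln (norm (1 - c * cis \<theta>))) has_integral
      (3*pi/2 - (-pi/2)) *\<^sub>R ln (max r (norm b)) + 0) {-pi/2..3*pi/2}"
    by (intro has_integral_add has_integral_ln_norm_one_minus_cis c has_integral_const_real[THEN has_integral_eq_rhs])
       simp_all
  then show ?thesis
    unfolding w eq using ne m by (simp add: ln_mult_pos)
qed

section \<open>Disc integrals by radius and angle\<close>

lemma ball_borel_measurable [measurable]: "ball a R \<in> sets borel"
  by (simp add: borel_open)

text \<open>Connects Lebesgue integrals over discs with the gauge integrals in angle and radius that
  antiderivatives provide. The exceptional set \<open>N\<close> admits radii at which the circle
  meets a singularity.\<close>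

lemma integral_ball_polar:
  fixes g :: "real \<times> real \<Rightarrow> real"
  assumes g: "set_integrable lborel (ball 0 R) g" and N: "finite N"
    and A: "\<And>r. r \<in> {0<..<R} - N \<Longrightarrow> ((\<lambda>\<theta>. g (r * cos \<theta>, r * sin \<theta>)) has_integral A r) {-pi/2..3*pi/2}"
    and J: "((\<lambda>r. r * A r) has_integral J) {0..R}"
  shows "(\<integral>z\<in>ball 0 R. g z \<partial>lborel) = J"
proof -
  let ?h = "\<lambda>z. indicator (ball 0 R) z * g z"
  let ?p = "\<lambda>p. polar_density p * ?h (polar p)"
  have h: "integrable lborel ?h" using g by (simp add: set_integrable_def)
  have i: "integrable (lborel \<Otimes>\<^sub>M lborel) ?p"
    by (rule integrable_polar[OF h])
  define G where "G r = (\<integral>\<theta>. ?p (r, \<theta>) \<partial>lborel)" for r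
  have G: "integrable lborel G"
    unfolding G_def using lborel_pair.integrable_fst'[OF i] by simp
  have eq: "(\<integral>z\<in>ball 0 R. g z \<partial>lborel) = integral\<^sup>L lborel G"
    using integral_polar[OF h] by (simp add: set_lebesgue_integral_def G_def[abs_def])
  \<comment> \<open>Fubini's theorem makes the angular slices integrable only for almost every
    radius. The bad null set, \<open>N\<close> and the endpoint R are discarded together as a
    negligible set.\<close>
  have "AE r in lborel. integrable lborel (\<lambda>\<theta>. ?p (r, \<theta>))"
    using lborel_pair.AE_integrable_fst'[OF i] by simp
  then obtain M where M: "M \<in> null_sets lborel"
    and "{r \<in> space lborel. \<not> integrable lborel (\<lambda>\<theta>. ?p (r, \<theta>))} \<subseteq> M"
    unfolding eventually_ae_filter by blast
  then have M2: "integrable lborel (\<lambda>\<theta>. ?p (r, \<theta>))" if "r \<notin> M" for r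
    using that by auto
  have "negligible M"
    unfolding negligible_iff_null_sets using M by (rule null_sets_completionI)
  with N have negl: "negligible (M \<union> N \<union> {R})"
    by (intro negligible_Un) auto
  have "G r = (if r \<in> {0..R} then r * A r else 0)" if "r \<notin> M \<union> N \<union> {R}" for r
  proof (cases "r \<in> {0<..<R}")
    case True
    then have nn: "norm (r * cos \<theta>, r * sin \<theta>) = r" for \<theta>
      by (simp add: norm_prod_def power_mult_distrib flip: distrib_left)
    have "((\<lambda>\<theta>. ?p (r, \<theta>)) has_integral G r) UNIV"
      unfolding G_def using M2[of r] that by (intro has_integral_integral_lborel) auto
    also have "(\<lambda>\<theta>. ?p (r, \<theta>)) = (\<lambda>\<theta>. if \<theta> \<in> {-pi/2..3*pi/2} then r * g (r * cos \<theta>, r * sin \<theta>) else 0)"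
      using True by (auto simp: polar_density_def polar_def nn split: split_indicator)
    finally have "((\<lambda>\<theta>. r * g (r * cos \<theta>, r * sin \<theta>)) has_integral G r) {-pi/2..3*pi/2}"
      by (simp only: has_integral_restrict_UNIV)
    moreover have "((\<lambda>\<theta>. r * g (r * cos \<theta>, r * sin \<theta>)) has_integral r * A r) {-pi/2..3*pi/2}"
      using A[of r] True that by (intro has_integral_mult_right) auto
    ultimately have "G r = r * A r" by (rule has_integral_unique)
    then show ?thesis using True by auto
  next
    case False
    have "?p (r, \<theta>) = 0" for \<theta>
    proof (cases "r > 0")
      case True
      then have "norm (r * cos \<theta>, r * sin \<theta>) = r"
        by (simp add: norm_prod_def power_mult_distrib flip: distrib_left)
      with True False show ?thesis by (simp add: polar_def)
    qed (simp add: polar_density_def)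
    then have "G r = 0" by (simp only: G_def integral_zero)
    with False that show ?thesis by auto
  qed
  moreover have "((\<lambda>r. if r \<in> {0..R} then r * A r else 0) has_integral J) UNIV"
    using J by (simp only: has_integral_restrict_UNIV)
  ultimately have "(G has_integral J) UNIV"
    using has_integral_spike[OF negl, of UNIV G] by auto
  with has_integral_integral_lborel[OF G] show ?thesis
    unfolding eq using has_integral_unique by blast
qed

section \<open>Integrable singularities: 1 / |z| and ln |z|\<close>

lemma nn_integral_inverse_norm_ball:
  assumes "R \<ge> 0"
  shows "(\<integral>\<^sup>+z. ennreal (indicator (ball (0::real \<times> real) R) z / norm z) \<partial>lborel) = ennreal (2 * pi * R)"
proof -
  have "(\<integral>\<^sup>+z. ennreal (indicator (ball (0::real \<times> real) R) z / norm z) \<partial>lborel) =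
    (\<integral>\<^sup>+r. \<integral>\<^sup>+\<theta>. ennreal (r * indicator {0<..} r * indicator {-pi/2..3*pi/2} \<theta>) *
      ennreal (indicator (ball 0 R) (r * cos \<theta>, r * sin \<theta>) / norm (r * cos \<theta>, r * sin \<theta>)) \<partial>lborel \<partial>lborel)"
    by (rule nn_integral_polar) simp
  also have "\<dots> = (\<integral>\<^sup>+r. \<integral>\<^sup>+\<theta>. indicator {0<..<R} r * indicator {-pi/2..3*pi/2} \<theta> \<partial>lborel \<partial>lborel)"
  proof (intro nn_integral_cong)
    fix r \<theta> :: real
    have "norm (r * cos \<theta>, r * sin \<theta>) = r" if "r > 0"
      using that by (simp add: norm_prod_def power_mult_distrib flip: distrib_left)
    then show "ennreal (r * indicator {0<..} r * indicator {-pi/2..3*pi/2} \<theta>) *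
      ennreal (indicator (ball 0 R) (r * cos \<theta>, r * sin \<theta>) / norm (r * cos \<theta>, r * sin \<theta>)) =
      indicator {0<..<R} r * indicator {-pi/2..3*pi/2} \<theta>"
      by (auto simp flip: ennreal_mult split: split_indicator)
  qed
  also have "\<dots> = ennreal (2 * pi * R)"
    using assms by (simp add: nn_integral_cmult nn_integral_multc mult.commute flip: ennreal_mult)
  finally show ?thesis .
qed

lemma
  fixes f :: "'a::euclidean_space \<Rightarrow> real"
  shows lborel_integrable_translate: "integrable lborel (\<lambda>x. f (c + x)) \<longleftrightarrow> integrable lborel f" (is ?A)
    and lborel_integral_translate: "(\<integral>x. f (c + x) \<partial>lborel) = (\<integral>x. f x \<partial>lborel)" (is ?B)
proof -
  have 1: "integrable lborel (\<lambda>x. f (c + x))" if "integrable lborel f" for f :: "'a \<Rightarrow> real" and c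
  proof -
    have "(+) c \<in> lborel \<rightarrow>\<^sub>M borel" by simp
    moreover have "integrable (distr lborel borel ((+) c)) f" using that by (simp only: lborel_distr_plus)
    ultimately show ?thesis by (rule integrable_distr)
  qed
  show ?A using 1[of f c] 1[of "\<lambda>x. f (c + x)" "-c"] by auto
  show ?B
  proof (cases "f \<in> borel_measurable borel")
    case True
    have "(\<integral>x. f x \<partial>lborel) = (\<integral>x. f x \<partial>distr lborel borel ((+) c))" by (simp only: lborel_distr_plus)
    also have "\<dots> = (\<integral>x. f (c + x) \<partial>lborel)" using True by (intro integral_distr) simp_all
    finally show ?thesis by simp
  next
    \<comment> \<open>For non-measurable \<open>f\<close> neither side is integrable, and both
      integrals take the default value 0.\<close>
    case False
    then have "\<not> integrable lborel f" by auto
    with \<open>?A\<close> show ?thesis by (simp add: not_integrable_integral_eq)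
  qed
qed

lemma set_integrable_inverse_norm:
  "set_integrable lborel (ball a R) (\<lambda>z::real \<times> real. 1 / norm (z - b))"
proof -
  define S where "S = max 0 R + norm a + norm b"
  have "integrable lborel (\<lambda>z. indicator (ball (0::real \<times> real) S) z / norm z)"
  proof (rule integrableI_nonneg)
    have "S \<ge> 0" by (simp add: S_def)
    then show "(\<integral>\<^sup>+z. ennreal (indicator (ball (0::real \<times> real) S) z / norm z) \<partial>lborel) < \<infinity>"
      by (subst nn_integral_inverse_norm_ball) auto
  qed auto
  then have *: "integrable lborel (\<lambda>z. indicator (ball (0::real \<times> real) S) (-b + z) / norm (-b + z))"
    by (subst lborel_integrable_translate[where f="\<lambda>z. indicator (ball 0 S) z / norm z"])
  show ?thesis unfolding set_integrable_def
  proof (rule Bochner_Integration.integrable_bound[OF *])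
    have "norm (z - b) < S" if "z \<in> ball a R" for z
    proof -
      have "norm (z - b) \<le> norm (z - a) + norm a + norm b" by norm
      also have "\<dots> < S" using that unfolding S_def by (auto simp: dist_norm norm_minus_commute)
      finally show ?thesis .
    qed
    then show "AE z in lborel. norm (indicat_real (ball a R) z *\<^sub>R (1 / norm (z - b))) \<le>
      norm (indicat_real (ball 0 S) (- b + z) / norm (- b + z))"
      by (intro AE_I2) (auto split: split_indicator)
  qed auto
qed

text \<open>Reduces the logarithmic singularity to that of 1 / t. At t = 0 the conventions
  \<open>ln 0 = 0\<close> and \<open>1 / 0 = 0\<close> make both sides vanish.\<close>

lemma abs_ln_le:
  fixes t :: real assumes "t \<ge> 0" shows "\<bar>ln t\<bar> \<le> 1 / t + t"
proof (cases "t = 0")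
  case False
  then have "t > 0" using assms by simp
  then have "ln t \<le> t" "ln (1/t) \<le> 1/t" using ln_bound[of t] ln_bound[of "1/t"] by auto
  moreover have "1 / t > 0" using \<open>t > 0\<close> by simp
  ultimately show ?thesis using \<open>t > 0\<close>  unfolding ln_divide_pos[OF zero_less_one \<open>t > 0\<close>] ln_one by linarith
qed simp

lemma set_integrable_ln_norm:
  "set_integrable lborel (ball a R) (\<lambda>z::real \<times> real. ln (norm (z - b)))"
proof -
  have i: "set_integrable lborel (ball a R) (\<lambda>z::real \<times> real. 1 / norm (z - b) + (\<bar>R\<bar> + norm (a - b)))"
  proof (rule set_integral_add(1)[OF set_integrable_inverse_norm])
    have "emeasure lborel (ball a R) < \<infinity>" by (rule emeasure_lborel_ball_finite)
    then show "set_integrable lborel (ball a R) (\<lambda>z. \<bar>R\<bar> + norm (a - b))"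
      unfolding set_integrable_def by (intro integrable_scaleR_left integrable_real_indicator) auto
  qed
  show ?thesis
  proof (rule set_integrable_bound[OF i])
    show "AE z in lborel. z \<in> ball a R \<longrightarrow> norm (ln (norm (z - b))) \<le> norm (1 / norm (z - b) + (\<bar>R\<bar> + norm (a - b)))"
    proof (intro AE_I2 impI)
      fix z assume "z \<in> ball a R"
      then have "norm (z - b) \<le> \<bar>R\<bar> + norm (a - b)"
        using norm_triangle_ineq[of "z - a" "a - b"] by (auto simp: dist_norm norm_minus_commute)
      with abs_ln_le[of "norm (z - b)"]
      show "norm (ln (norm (z - b))) \<le> norm (1 / norm (z - b) + (\<bar>R\<bar> + norm (a - b)))" by simp
    qed
  qed (auto simp: set_borel_measurable_def)
qed

text \<open>The average of ln |z - b| over the disc of radius R around 0, as a function of s = |b|.\<close>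

definition log_mean :: "real \<Rightarrow> real \<Rightarrow> real" where
  "log_mean R s = (if s < R then ln R + (s\<^sup>2 / R\<^sup>2 - 1) / 2 else ln s)"

lemma integral_ln_norm_ball:
  fixes b :: "real \<times> real"
  assumes R: "R > 0" and b: "b \<noteq> 0"
  shows "(\<integral>z\<in>ball 0 R. ln (norm (z - b)) \<partial>lborel) = pi * R\<^sup>2 * log_mean R (norm b)"
proof (rule integral_ball_polar[where N="{norm b}"])
  show "set_integrable lborel (ball 0 R) (\<lambda>z. ln (norm (z - b)))" by (rule set_integrable_ln_norm)
  show "((\<lambda>\<theta>. ln (norm ((r * cos \<theta>, r * sin \<theta>) - b))) has_integral 2 * pi * ln (max r (norm b))) {-pi/2..3*pi/2}"
    if "r \<in> {0<..<R} - {norm b}" for r using that b by (intro has_integral_ln_norm_circle) auto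
  have b': "norm b > 0" using b by simp
  \<comment> \<open>Up to radius |b| the maximum is the constant |b|; beyond it the integrand
    becomes 2 pi r ln r. A disc that does not reach past |b| sees only the first regime, and the
    average is then ln |b| itself.\<close>
  have 1: "((\<lambda>r. r * (2 * pi * ln (max r (norm b)))) has_integral pi * S\<^sup>2 * ln (norm b) - pi * 0\<^sup>2 * ln (norm b)) {0..S}"
    if "0 \<le> S" "S \<le> norm b" for S
    by (rule has_integral_eq[rotated], rule fundamental_theorem_of_calculus[where f="\<lambda>r. pi * r\<^sup>2 * ln (norm b)"])
       (use that in \<open>auto intro!: derivative_eq_intros simp flip: has_real_derivative_iff_has_vector_derivative simp: max_def\<close>)
  show "((\<lambda>r. r * (2 * pi * ln (max r (norm b)))) has_integral pi * R\<^sup>2 * log_mean R (norm b)) {0..R}"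
  proof (cases "norm b < R")
    case False
    with 1[of R] R show ?thesis by (simp add: log_mean_def)
  next
    case True
    let ?F = "\<lambda>r. pi * r\<^sup>2 * ln r - pi * r\<^sup>2 / 2"
    have 2: "((\<lambda>r. r * (2 * pi * ln (max r (norm b)))) has_integral ?F R - ?F (norm b)) {norm b..R}"
    proof (rule has_integral_eq[rotated], rule fundamental_theorem_of_calculus[where f="?F" and f'="\<lambda>r. 2 * pi * r * ln r"])
      fix r assume "r \<in> {norm b..R}"
      then have "norm b \<le> r" by simp
      with b' have "r > 0" by linarith
      then have "(?F has_real_derivative 2 * pi * r * ln r) (at r within {norm b..R})"
        by (auto intro!: derivative_eq_intros simp: power2_eq_square)
      then show "(?F has_vector_derivative 2 * pi * r * ln r) (at r within {norm b..R})"
        by (simp add: has_real_derivative_iff_has_vector_derivative)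
    qed (use True in \<open>auto simp: max_def\<close>)
    have "((\<lambda>r. r * (2 * pi * ln (max r (norm b)))) has_integral pi * (norm b)\<^sup>2 * ln (norm b) + (?F R - ?F (norm b))) {0..R}"
      using 1[of "norm b"] True b' by (intro has_integral_combine[OF _ _ _ 2]) auto
    also have "pi * (norm b)\<^sup>2 * ln (norm b) + (?F R - ?F (norm b)) = pi * R\<^sup>2 * log_mean R (norm b)"
      using True R by (simp add: log_mean_def field_simps)
    finally show ?thesis .
  qed
qed simp

section \<open>Jensen's formula\<close>

text \<open>\<open>pd\<close> is built from one-variable derivatives; differentiability identifies
  them as the components of the total derivative, and this gives the chain rule along
  curves.\<close>

lemma has_derivative_pd:
  assumes "f differentiable at p"
  shows "(f has_derivative (\<lambda>h. pd 1 f p * fst h + pd 2 f p * snd h)) (at p)"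
proof -
  obtain a b where p: "p = (a, b)" by (cases p)
  obtain D where D: "(f has_derivative D) (at p)" using assms by (auto simp: differentiable_def)
  then have lin: "linear D" by (rule has_derivative_linear)
  have "((\<lambda>t. f (t, b)) has_derivative (\<lambda>h. D (h, 0))) (at a)"
    by (rule has_derivative_compose[where g=f and f="\<lambda>t. (t, b)"])
      (use D p in \<open>auto intro!: derivative_eq_intros\<close>)
  moreover have "(\<lambda>h. D (h, 0)) = (*) (D (1, 0))"
  proof
    fix h :: real
    have "D (h, 0) = D (h *\<^sub>R (1, 0))" by simp
    also have "\<dots> = D (1, 0) * h" by (simp only: linear_scale[OF lin] real_scaleR_def mult.commute)
    finally show "D (h, 0) = D (1, 0) * h" .
  qed
  ultimately have "((\<lambda>t. f (t, b)) has_real_derivative D (1, 0)) (at a)"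
    by (simp add: has_field_derivative_def)
  then have 1: "pd 1 f p = D (1, 0)" by (simp add: pd_def p DERIV_imp_deriv)
  have "((\<lambda>t. f (a, t)) has_derivative (\<lambda>h. D (0, h))) (at b)"
    by (rule has_derivative_compose[where g=f and f="\<lambda>t. (a, t)"])
      (use D p in \<open>auto intro!: derivative_eq_intros\<close>)
  moreover have "(\<lambda>h. D (0, h)) = (*) (D (0, 1))"
  proof
    fix h :: real
    have "D (0, h) = D (h *\<^sub>R (0, 1))" by simp
    also have "\<dots> = D (0, 1) * h" by (simp only: linear_scale[OF lin] real_scaleR_def mult.commute)
    finally show "D (0, h) = D (0, 1) * h" .
  qed
  ultimately have "((\<lambda>t. f (a, t)) has_real_derivative D (0, 1)) (at b)"
    by (simp add: has_field_derivative_def)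
  then have 2: "pd 2 f p = D (0, 1)" by (simp add: pd_def p DERIV_imp_deriv)
  have "D h = pd 1 f p * fst h + pd 2 f p * snd h" for h
  proof -
    have "D h = D (fst h *\<^sub>R (1, 0) + snd h *\<^sub>R (0, 1))" by simp
    also have "\<dots> = fst h * D (1, 0) + snd h * D (0, 1)"
      by (simp only: linear_add[OF lin] linear_scale[OF lin] real_scaleR_def)
    finally show ?thesis by (simp only: 1 2 mult.commute)
  qed
  then have "D = (\<lambda>h. pd 1 f p * fst h + pd 2 f p * snd h)" by (rule ext)
  then show ?thesis using D by (simp only:)
qed

lemma DERIV_along_curve:
  assumes "f differentiable at (X t, Y t)"
    and "(X has_real_derivative X') (at t)" "(Y has_real_derivative Y') (at t)"
  shows "((\<lambda>t. f (X t, Y t)) has_real_derivative pd 1 f (X t, Y t) * X' + pd 2 f (X t, Y t) * Y') (at t)"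
proof -
  have "((\<lambda>t. (X t, Y t)) has_derivative (\<lambda>h. (X' * h, Y' * h))) (at t)"
    using assms(2,3) by (auto intro!: has_derivative_Pair simp: has_field_derivative_def)
  from has_derivative_compose[OF this has_derivative_pd[OF assms(1)]] show ?thesis
    unfolding has_field_derivative_def
    by (rule has_derivative_eq_rhs) (simp add: fun_eq_iff algebra_simps)
qed

lemma smooth2_differentiable:
  assumes "smooth2 u" "set is \<subseteq> {1, 2}"
  shows "dop is u differentiable at p"
  using assms unfolding smooth2_def differentiable_on_def by blast

lemma smooth2_continuous:
  assumes "smooth2 u" "set is \<subseteq> {1, 2}"
  shows "continuous_on S (dop is u)"
  using assms differentiable_imp_continuous_on unfolding smooth2_def
  by (metis continuous_on_subset subset_UNIV)

text \<open>Equals log_mean R s - ln s for s < R.\<close>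

definition jensen_kernel :: "real \<Rightarrow> real \<Rightarrow> real" where
  "jensen_kernel R s = ln R - ln s + (s\<^sup>2 / R\<^sup>2 - 1) / 2"

section \<open>Circle integrals around a fixed centre\<close>

locale smooth_function =
  fixes u :: "real \<times> real \<Rightarrow> real" and a :: "real \<times> real"
  assumes smooth: "smooth2 u"
begin

abbreviation P :: "real \<Rightarrow> real \<Rightarrow> real \<times> real" where
  "P r \<theta> \<equiv> (fst a + r * cos \<theta>, snd a + r * sin \<theta>)"

abbreviation I :: "real set" where "I \<equiv> cbox (-pi/2) (3*pi/2)"

abbreviation "u1 \<equiv> pd 1 u"
abbreviation "u2 \<equiv> pd 2 u"

lemma diff: "u differentiable at p" "u1 differentiable at p" "u2 differentiable at p"
  using smooth2_differentiable[OF smooth, of "[]"] smooth2_differentiable[OF smooth, of "[1]"]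
    smooth2_differentiable[OF smooth, of "[2]"] by auto

lemma cont [continuous_intros]:
  assumes "continuous_on S f"
  shows "continuous_on S (\<lambda>x. u (f x))" "continuous_on S (\<lambda>x. u1 (f x))" "continuous_on S (\<lambda>x. u2 (f x))"
    "continuous_on S (\<lambda>x. pd 1 u1 (f x))" "continuous_on S (\<lambda>x. pd 1 u2 (f x))"
    "continuous_on S (\<lambda>x. pd 2 u1 (f x))" "continuous_on S (\<lambda>x. pd 2 u2 (f x))"
  using assms smooth2_continuous[OF smooth, of "[]"] smooth2_continuous[OF smooth, of "[1]"]
    smooth2_continuous[OF smooth, of "[2]"] smooth2_continuous[OF smooth, of "[1,1]"]
    smooth2_continuous[OF smooth, of "[1,2]"] smooth2_continuous[OF smooth, of "[2,1]"]
    smooth2_continuous[OF smooth, of "[2,2]"]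
  by (auto intro: continuous_on_compose2[where t=UNIV])

lemma cont_laplacian [continuous_intros]:
  "continuous_on S f \<Longrightarrow> continuous_on S (\<lambda>x. laplacian u (f x))"
  unfolding laplacian_def by (intro continuous_intros)

text \<open>\<open>Ur\<close>, \<open>Urr\<close> and \<open>Ut\<close> are the first and second
  radial and the first angular derivative of u in polar coordinates around a. The integrals over
  \<open>I\<close> are 2 pi times circle means.\<close>

definition "Ur r \<theta> = u1 (P r \<theta>) * cos \<theta> + u2 (P r \<theta>) * sin \<theta>"
definition "Urr r \<theta> = (pd 1 u1 (P r \<theta>) * cos \<theta> + pd 2 u1 (P r \<theta>) * sin \<theta>) * cos \<theta>
   + (pd 1 u2 (P r \<theta>) * cos \<theta> + pd 2 u2 (P r \<theta>) * sin \<theta>) * sin \<theta>"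
definition "Ut r \<theta> = r * (u2 (P r \<theta>) * cos \<theta> - u1 (P r \<theta>) * sin \<theta>)"
definition "\<phi> r = integral I (\<lambda>\<theta>. u (P r \<theta>))"
definition "\<phi>' r = integral I (Ur r)"
definition "\<phi>'' r = integral I (Urr r)"
definition "A r = integral I (\<lambda>\<theta>. laplacian u (P r \<theta>))"

lemma cont_Ur: "continuous_on S (Ur r)" and cont_Urr: "continuous_on S (Urr r)"
  unfolding Ur_def Urr_def by (intro continuous_intros)+

lemma deriv_\<phi>: "(\<phi> has_real_derivative \<phi>' r) (at r)"
  unfolding \<phi>_def \<phi>'_def
proof (rule leibniz_rule_field_derivative[where U=UNIV])
  fix r t
  show "((\<lambda>r. u (P r t)) has_real_derivative Ur r t) (at r within UNIV)"
    unfolding Ur_def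
    by (rule DERIV_along_curve[OF diff(1), THEN DERIV_cong]) (auto intro!: derivative_eq_intros)
next
  show "continuous_on (UNIV \<times> I) (\<lambda>(x, t). Ur x t)"
    unfolding Ur_def case_prod_beta by (intro continuous_intros)
  show "(\<lambda>\<theta>. u (P r \<theta>)) integrable_on I" for r
    by (intro integrable_continuous continuous_intros)
qed auto

lemma deriv_\<phi>': "(\<phi>' has_real_derivative \<phi>'' r) (at r)"
  unfolding \<phi>'_def \<phi>''_def
proof (rule leibniz_rule_field_derivative[where U=UNIV])
  fix r t
  show "((\<lambda>r. Ur r t) has_real_derivative Urr r t) (at r within UNIV)"
    unfolding Ur_def Urr_def
    by (rule DERIV_cong, rule DERIV_add;
      (rule DERIV_cmult_right DERIV_along_curve diff derivative_intros refl)+)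
      (auto intro!: derivative_eq_intros)
next
  show "continuous_on (UNIV \<times> I) (\<lambda>(x, t). Urr x t)"
    unfolding Urr_def case_prod_beta by (intro continuous_intros)
  show "Ur r integrable_on I" for r
    unfolding Ur_def by (intro integrable_continuous continuous_intros)
qed auto

text \<open>The second angular derivative integrates to zero by periodicity.\<close>

lemma polar_laplacian: "r * \<phi>' r + r\<^sup>2 * \<phi>'' r = r\<^sup>2 * A r"
proof -
  \<comment> \<open>\<open>?T\<close> is the second angular derivative, read off from the polar form
    r^2 Lap u = r u_r + r^2 u_rr + u_theta_theta. The mixed derivatives enter \<open>Urr\<close> and
    the derivative of \<open>Ut\<close> only through the sum \<open>pd 1 u2 + pd 2 u1\<close>, with
    opposite signs, and cancel.\<close>
  let ?T = "\<lambda>\<theta>. r\<^sup>2 * laplacian u (P r \<theta>) - (r * Ur r \<theta> + r\<^sup>2 * Urr r \<theta>)"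
  have d: "((\<lambda>\<theta>. Ut r \<theta>) has_real_derivative ?T \<theta>) (at \<theta>)" for \<theta>
  proof -
    have X: "((\<lambda>\<theta>. fst a + r * cos \<theta>) has_real_derivative - r * sin \<theta>) (at \<theta>)"
      and Y: "((\<lambda>\<theta>. snd a + r * sin \<theta>) has_real_derivative r * cos \<theta>) (at \<theta>)"
      by (auto intro!: derivative_eq_intros)
    show ?thesis
      unfolding Ut_def
      by (rule DERIV_cong, (rule derivative_intros DERIV_along_curve[OF diff(2) X Y] DERIV_along_curve[OF diff(3) X Y])+)
         (use sin_cos_squared_add3[of \<theta>] in \<open>simp only: Ur_def Urr_def laplacian_def power2_eq_square, algebra\<close>)
  qed
  have "(?T has_integral (Ut r (3*pi/2) - Ut r (-pi/2))) {-pi/2..3*pi/2}"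
    using d by (intro fundamental_theorem_of_calculus)
      (auto simp: has_real_derivative_iff_has_vector_derivative[symmetric] intro: DERIV_subset)
  moreover have "sin (3*pi/2) = -1" "cos (3*pi/2) = 0" "sin (-pi/2) = -1" "cos (-pi/2) = 0"
    using sin_3over2_pi cos_3over2_pi by simp_all
  then have "Ut r (3*pi/2) - Ut r (-pi/2) = 0" by (simp only: Ut_def)
  ultimately have "(?T has_integral 0) I" by simp
  moreover have "(?T has_integral r\<^sup>2 * A r - (r * \<phi>' r + r\<^sup>2 * \<phi>'' r)) I"
    unfolding A_def \<phi>'_def \<phi>''_def
    by (intro has_integral_diff has_integral_add has_integral_mult_right integrable_integral integrable_continuous
      continuous_intros cont_Ur cont_Urr)
  ultimately have "r\<^sup>2 * A r - (r * \<phi>' r + r\<^sup>2 * \<phi>'' r) = 0" using has_integral_unique by blast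
  then show ?thesis by simp
qed

lemma tendsto_r_ln_r: "((\<lambda>r::real. r * ln r) \<longlongrightarrow> 0) (at_right 0)"
  by real_asymp

text \<open>Green's identity in the radial variable. With k = \<open>jensen_kernel R\<close>, the
  antiderivative is k (r \<phi>') - (r k') \<phi>, and k' = r/R^2 - 1/r gives - r k' = 1 - r^2/R^2.
  It vanishes at R, since both k and k' do, and equals \<phi> 0 = 2 pi u(a) at 0.\<close>

lemma has_integral_jensen:
  assumes R: "R > 0"
  shows "((\<lambda>r. r * (jensen_kernel R r * A r - 2 / R\<^sup>2 * \<phi> r)) has_integral - 2 * pi * u a) {0..R}"
proof -
  let ?F = "\<lambda>r. jensen_kernel R r * (r * \<phi>' r) + \<phi> r - r\<^sup>2 / R\<^sup>2 * \<phi> r"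
  have c\<phi>: "continuous_on S \<phi>" "continuous_on S \<phi>'" for S
    using DERIV_isCont[OF deriv_\<phi>] DERIV_isCont[OF deriv_\<phi>'] by (auto intro: continuous_at_imp_continuous_on)
  \<comment> \<open>The kernel is singular at 0 and enters \<open>?F\<close> only multiplied by r.
    Since r ln r tends to 0, \<open>?F\<close> is continuous up to the left endpoint.\<close>
  define L :: "real \<Rightarrow> real" where "L r = r * ln r" for r
  have cL: "continuous_on {0..R} L"
    unfolding continuous_on_def L_def
  proof
    fix x assume x: "x \<in> {0..R}"
    show "((\<lambda>r. r * ln r) \<longlongrightarrow> x * ln x) (at x within {0..R})"
    proof (cases "x = 0")
      case True
      then show ?thesis using tendsto_r_ln_r R by (simp add: at_within_Icc_at_right)
    next
      case False
      then show ?thesis by (intro tendsto_intros) (use x in auto)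
    qed
  qed
  have "continuous_on {0..R} (\<lambda>r. (r * ln R - L r + r * ((r\<^sup>2 / R\<^sup>2 - 1) / 2)) * \<phi>' r + \<phi> r - r\<^sup>2 / R\<^sup>2 * \<phi> r)"
    by (intro continuous_intros c\<phi> cL) (use R in auto)
  then have cF: "continuous_on {0..R} ?F"
    by (rule continuous_on_eq) (simp add: L_def jensen_kernel_def algebra_simps)
  have dF: "(?F has_real_derivative r * (jensen_kernel R r * A r - 2 / R\<^sup>2 * \<phi> r)) (at r)" if "r \<in> {0<..<R}" for r
  proof -
    have r: "r > 0" using that by simp
    have k: "(jensen_kernel R has_real_derivative r / R\<^sup>2 - 1 / r) (at r)"
      unfolding jensen_kernel_def[abs_def] using r R
      by (auto intro!: derivative_eq_intros simp: power2_eq_square)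
    have "r * (\<phi>' r + r * \<phi>'' r) = r * (r * A r)"
      using polar_laplacian[of r] by (simp add: power2_eq_square algebra_simps)
    then have e: "\<phi>' r + r * \<phi>'' r = r * A r" using r by simp
    have sq: "((\<lambda>r. r\<^sup>2 / R\<^sup>2) has_real_derivative 2 * r / R\<^sup>2) (at r)"
      using R by (auto intro!: derivative_eq_intros simp: power2_eq_square)
    have e2: "(r / R\<^sup>2 - 1 / r) * (r * \<phi>' r) + \<phi>' r - r\<^sup>2 / R\<^sup>2 * \<phi>' r = 0"
      using r by (simp add: field_simps power2_eq_square)
    have "(?F has_real_derivative (r / R\<^sup>2 - 1 / r) * (r * \<phi>' r) + jensen_kernel R r * (\<phi>' r + r * \<phi>'' r) + \<phi>' r
        - (2 * r / R\<^sup>2 * \<phi> r + r\<^sup>2 / R\<^sup>2 * \<phi>' r)) (at r)"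
      by (rule DERIV_cong[OF DERIV_diff[OF DERIV_add[OF DERIV_mult[OF k DERIV_mult[OF DERIV_ident deriv_\<phi>']] deriv_\<phi>]
        DERIV_mult[OF sq deriv_\<phi>]]]) (simp add: algebra_simps)
    then show ?thesis
      by (rule DERIV_cong) (use e2 in \<open>simp only: e, simp add: algebra_simps\<close>)
  qed
  have "((\<lambda>r. r * (jensen_kernel R r * A r - 2 / R\<^sup>2 * \<phi> r)) has_integral ?F R - ?F 0) {0..R}"
    using R cF dF by (intro fundamental_theorem_of_calculus_interior)
      (auto simp: has_real_derivative_iff_has_vector_derivative[symmetric])
  moreover have "\<phi> 0 = 2 * pi * u a"
    by (simp add: \<phi>_def)
  then have "?F R - ?F 0 = - 2 * pi * u a"
    using R by (simp add: jensen_kernel_def)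
  ultimately show ?thesis by (simp only:)
qed

text \<open>Polar integration evaluates the combined integrand. Splitting it needs each part
  integrable: the Laplacian is bounded on the closed disc, and the kernel has only a logarithmic
  singularity.\<close>

lemma jensen_formula:
  assumes R: "R > 0"
  shows "set_integrable lborel (ball 0 R) (\<lambda>z. jensen_kernel R (norm z) * laplacian u (a + z))" (is ?A)
    and "set_integrable lborel (ball 0 R) (\<lambda>z. u (a + z))" (is ?B)
    and "(\<integral>z\<in>ball 0 R. jensen_kernel R (norm z) * laplacian u (a + z) \<partial>lborel)
      - 2 / R\<^sup>2 * (\<integral>z\<in>ball 0 R. u (a + z) \<partial>lborel) = - 2 * pi * u a"
proof -
  have "continuous_on (cball 0 R) (\<lambda>z. laplacian u (a + z))" by (intro continuous_intros)
  then obtain B where B: "\<And>z. z \<in> cball 0 R \<Longrightarrow> norm (laplacian u (a + z)) \<le> B"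
    using compact_continuous_image[of "cball 0 R"] compact_imp_bounded bounded_iff
    by (metis (no_types, lifting) compact_cball image_eqI)
  have lm: "(\<lambda>z. laplacian u (a + z)) \<in> borel_measurable borel"
    by (intro borel_measurable_continuous_onI continuous_intros)
  have const: "set_integrable lborel (ball (0::real \<times> real) R) (\<lambda>z. c)" for c :: real
    unfolding set_integrable_def
    by (intro integrable_scaleR_left integrable_real_indicator emeasure_lborel_ball_finite) auto
  have i: "set_integrable lborel (ball (0::real \<times> real) R) (\<lambda>z. \<bar>B\<bar> * (\<bar>ln R\<bar> + 1 + \<bar>ln (norm (z - 0))\<bar>))"
    by (intro set_integral_add set_integrable_mult_right set_integrable_abs set_integrable_ln_norm const)
  show 1: ?A
  proof (rule set_integrable_bound[OF i])
    show "AE z in lborel. z \<in> ball 0 R \<longrightarrow> norm (jensen_kernel R (norm z) * laplacian u (a + z)) \<le>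
       norm (\<bar>B\<bar> * (\<bar>ln R\<bar> + 1 + \<bar>ln (norm (z - 0))\<bar>))"
    proof (intro AE_I2 impI)
      fix z :: "real \<times> real" assume z: "z \<in> ball 0 R"
      then have "(norm z)\<^sup>2 \<le> R\<^sup>2" by (intro power_mono) auto
      define t where "t = (norm z)\<^sup>2 / R\<^sup>2"
      have "0 \<le> t" "t \<le> 1" using R \<open>(norm z)\<^sup>2 \<le> R\<^sup>2\<close> by (auto simp: t_def)
      define w where "w = (t - 1) / 2"
      have w: "w \<le> 0" "- 1 \<le> w" using \<open>0 \<le> t\<close> \<open>t \<le> 1\<close> by (auto simp: w_def)
      then have "\<bar>jensen_kernel R (norm z)\<bar> \<le> \<bar>ln R\<bar> + 1 + \<bar>ln (norm (z - 0))\<bar>"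
        unfolding jensen_kernel_def diff_zero t_def[symmetric] w_def[symmetric]
        using w by linarith
      moreover have "\<bar>laplacian u (a + z)\<bar> \<le> \<bar>B\<bar>" using B[of z] z by auto
      ultimately show "norm (jensen_kernel R (norm z) * laplacian u (a + z)) \<le>
       norm (\<bar>B\<bar> * (\<bar>ln R\<bar> + 1 + \<bar>ln (norm (z - 0))\<bar>))"
        unfolding real_norm_def abs_mult abs_abs by (subst mult.commute, intro mult_mono) auto
    qed
  qed (use lm in \<open>auto simp: set_borel_measurable_def jensen_kernel_def\<close>)
  have "set_integrable lborel (cball 0 R) (\<lambda>z. u (a + z))"
    unfolding set_integrable_def by (intro borel_integrable_compact continuous_intros compact_cball)
  then show 2: ?B
    by (rule set_integrable_subset) auto
  have "(\<integral>z\<in>ball 0 R. jensen_kernel R (norm z) * laplacian u (a + z) - 2 / R\<^sup>2 * u (a + z) \<partial>lborel) = - 2 * pi * u a"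
  proof (rule integral_ball_polar[where N="{}"])
    show "set_integrable lborel (ball 0 R) (\<lambda>z. jensen_kernel R (norm z) * laplacian u (a + z) - 2 / R\<^sup>2 * u (a + z))"
      by (intro set_integral_diff set_integrable_mult_right 1 2)
    show "((\<lambda>r. r * (jensen_kernel R r * A r - 2 / R\<^sup>2 * \<phi> r)) has_integral - 2 * pi * u a) {0..R}"
      by (rule has_integral_jensen[OF R])
    fix r assume r: "r \<in> {0<..<R} - {}"
    then have nn: "norm (r * cos \<theta>, r * sin \<theta>) = r" for \<theta>
      by (simp add: norm_prod_def power_mult_distrib flip: distrib_left)
    have aP: "a + (r * cos \<theta>, r * sin \<theta>) = P r \<theta>" for \<theta> by (simp add: plus_prod_def)
    show "((\<lambda>\<theta>. jensen_kernel R (norm (r * cos \<theta>, r * sin \<theta>)) * laplacian u (a + (r * cos \<theta>, r * sin \<theta>)) -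
         2 / R\<^sup>2 * u (a + (r * cos \<theta>, r * sin \<theta>))) has_integral jensen_kernel R r * A r - 2 / R\<^sup>2 * \<phi> r) {-pi/2..3*pi/2}"
      unfolding nn aP A_def \<phi>_def cbox_interval
      by (intro has_integral_diff has_integral_mult_right integrable_integral integrable_continuous_real continuous_intros)
  qed simp
  then show "(\<integral>z\<in>ball 0 R. jensen_kernel R (norm z) * laplacian u (a + z) \<partial>lborel)
      - 2 / R\<^sup>2 * (\<integral>z\<in>ball 0 R. u (a + z) \<partial>lborel) = - 2 * pi * u a"
    using set_integral_diff(2)[OF 1 set_integrable_mult_right[OF 2, of "2 / R\<^sup>2"]] by simp
qed

end

section \<open>Logarithmic potentials\<close>

text \<open>Here w stands for |f y|. Near y = 0 the bound w \<le> |y| absorbs 1 / |y|, at cost 1 on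
  the unit disc. Near y = x one has w \<le> 1 + |x|, and the radius 1 / (1 + |x|) is chosen so that
  (1 + |x|) times the integral of 1 / |y - x| over that disc is 2 pi for every x. Elsewhere the
  logarithm is at most 2 ln(1 + |x|) in modulus.\<close>

lemma log_ratio_bound:
  fixes x y :: "real \<times> real"
  assumes w: "0 \<le> w" "w \<le> norm y"
  shows "\<bar>ln (norm (x - y) / norm y)\<bar> * w \<le> 2 * ln (1 + norm x) * w + indicator (ball 0 1) y
     + (1 + norm x) * (indicator (ball 0 (1 / (1 + norm x))) (- x + y) / norm (- x + y))"
proof -
  define s t X where "s = norm (x - y)" and "t = norm y" and "X = norm x"
  have tri: "t \<le> s + X" "s \<le> t + X"
    using norm_triangle_ineq[of "y - x" x] norm_triangle_ineq4[of x y]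
    by (simp_all add: s_def t_def X_def norm_minus_commute)
  have nn: "s \<ge> 0" "t \<ge> 0" "X \<ge> 0" by (simp_all add: s_def t_def X_def)
  have sx: "norm (y - x) = s" by (simp add: s_def norm_minus_commute)
  define I1 I2 :: real where "I1 = (if t < 1 then 1 else 0)" and "I2 = (if s < 1 / (1 + X) then 1 / s else 0)"
  have L: "ln (1 + X) \<ge> 0" using nn by simp
  have I: "I1 \<ge> 0" "(1 + X) * I2 \<ge> 0" using nn by (auto simp: I1_def I2_def)
  have "\<bar>ln (s / t)\<bar> * w \<le> 2 * ln (1 + X) * w + I1 + (1 + X) * I2"
  proof (cases "s = 0 \<or> t = 0")
    case True
    \<comment> \<open>The quotient s / t is 0 in both cases, by the convention on division by 0 when
      t = 0, and \<open>ln 0 = 0\<close>.\<close>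
    then have "\<bar>ln (s / t)\<bar> * w = 0" by auto
    moreover have "2 * ln (1 + X) * w \<ge> 0" using L w by simp
    ultimately show ?thesis using I by linarith
  next
    case False
    then have st: "s > 0" "t > 0" using nn by auto
    \<comment> \<open>From above the logarithm is dangerous only for y near 0 (\<open>A\<close>);
      its negative only for y near x (\<open>B\<close>).\<close>
    have A: "ln (s / t) * w \<le> ln (1 + X) * w + I1"
    proof (cases "t < 1")
      case True
      have "ln s \<le> ln (1 + X)" using tri(2) True st by simp
      moreover have "- ln t \<le> 1 / t" using ln_bound[of "1 / t"] st by (simp add: ln_divide_pos)
      ultimately have "ln (s / t) * w \<le> (ln (1 + X) + 1 / t) * w"
        using w(1) st by (intro mult_right_mono) (simp_all add: ln_divide_pos)
      moreover have "1 / t * w \<le> 1" using w(2) st by (simp add: t_def[symmetric])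
      ultimately show ?thesis using True unfolding I1_def distrib_right by simp
    next
      case False
      have "s \<le> (1 + X) * t"
        using tri(2) False nn mult_left_mono[of 1 t X] by (simp add: algebra_simps)
      then have "s / t \<le> 1 + X" using st by (simp add: divide_le_eq)
      then have "ln (s / t) \<le> ln (1 + X)" using st nn by (subst ln_le_cancel_iff) auto
      with w(1) False show ?thesis by (simp add: I1_def mult_right_mono)
    qed
    have B: "ln (t / s) * w \<le> 2 * ln (1 + X) * w + (1 + X) * I2"
    proof (cases "s < 1 / (1 + X)")
      case True
      have "1 / (1 + X) \<le> 1" using nn by simp
      with True have s1: "s \<le> 1" by linarith
      have "ln t \<le> ln (1 + X)" using tri(1) s1 st by simp
      moreover have "- ln s \<le> 1 / s" using ln_bound[of "1 / s"] st by (simp add: ln_divide_pos)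
      ultimately have "ln (t / s) * w \<le> (ln (1 + X) + 1 / s) * w"
        using w(1) st by (intro mult_right_mono) (simp_all add: ln_divide_pos)
      moreover have "w / s \<le> (1 + X) / s" using w(2) tri(1) s1 st unfolding t_def[symmetric]
        by (intro divide_right_mono) auto
      moreover have "ln (1 + X) * w \<ge> 0" using L w by simp
      ultimately show ?thesis using True unfolding I2_def distrib_right by (simp add: add_divide_distrib)
    next
      case False
      \<comment> \<open>Away from x, t \<le> s + X \<le> s (1 + X + X^2) \<le> (1 + X)^2 s; this
        square is the source of the factor 2 in the growth term.\<close>
      then have "1 \<le> s * (1 + X)" using nn by (simp add: divide_le_eq not_less)
      then have "X \<le> X * (s * (1 + X))" using nn mult_left_mono[of 1 "s * (1 + X)" X] by simp
      moreover have "0 \<le> X * s" using nn by simp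
      ultimately have "t \<le> (1 + X)\<^sup>2 * s"
        using tri(1) by (simp add: power2_eq_square algebra_simps)
      then have "t / s \<le> (1 + X)\<^sup>2" using st by (simp add: divide_le_eq)
      then have "ln (t / s) \<le> ln ((1 + X)\<^sup>2)" using st nn by (subst ln_le_cancel_iff) auto
      also have "\<dots> = 2 * ln (1 + X)" using nn by (simp add: ln_realpow)
      finally show ?thesis using w(1) False by (simp add: I2_def mult_right_mono)
    qed
    have "ln (t / s) = - ln (s / t)" using st by (simp add: ln_divide_pos)
    moreover have "ln (1 + X) * w \<ge> 0" using L w by simp
    ultimately show ?thesis using A B I by (cases "ln (s / t) \<ge> 0") (auto simp: abs_if)
  qed
  moreover have "I1 = indicator (ball 0 1) y" "I2 = indicator (ball 0 (1 / (1 + X))) (- x + y) / norm (- x + y)"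
    by (simp_all add: I1_def I2_def t_def sx indicator_def)
  ultimately show ?thesis by (simp add: s_def t_def X_def)
qed

lemma log_mean_eq: "log_mean R s = ln s + indicator {..<R} s * jensen_kernel R s"
  by (simp add: log_mean_def jensen_kernel_def)

lemma
  assumes "R \<ge> 0"
  shows integrable_inverse_norm_ball: "integrable lborel (\<lambda>z. indicator (ball (0::real \<times> real) R) z / norm z)"
    and integral_inverse_norm_ball: "(\<integral>z. indicator (ball (0::real \<times> real) R) z / norm z \<partial>lborel) = 2 * pi * R"
proof -
  have "has_bochner_integral lborel (\<lambda>z. indicator (ball (0::real \<times> real) R) z / norm z) (2 * pi * R)"
    using nn_integral_inverse_norm_ball[OF assms] assms by (intro has_bochner_integral_nn_integral) auto
  then show "integrable lborel (\<lambda>z. indicator (ball (0::real \<times> real) R) z / norm z)"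
    "(\<integral>z. indicator (ball (0::real \<times> real) R) z / norm z \<partial>lborel) = 2 * pi * R"
    by (auto simp: has_bochner_integral_iff)
qed

lemma AE_lborel_neq: "AE y in lborel. y \<noteq> (c::real \<times> real)"
  by (rule AE_I[where N="{c}"]) auto

text \<open>Only integrability and the linear bound are kept, so that the signed density and its two
  parts with weights \<open>Kp\<close> and \<open>Km\<close> are all instances.\<close>

locale log_potential =
  fixes f :: "real \<times> real \<Rightarrow> real"
  assumes int_f: "integrable lborel f" and f_le: "\<And>y. \<bar>f y\<bar> \<le> norm y"
begin

lemma f_measurable [measurable]: "f \<in> borel_measurable borel"
  using int_f by auto

definition pot :: "real \<times> real \<Rightarrow> real" where
  "pot x = (\<integral>y. ln (norm (x - y) / norm y) * f y \<partial>lborel)"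

text \<open>The integral of the majorant in \<open>log_ratio_bound\<close>: pi is the area of the
  unit disc, and 2 pi comes from the singularity at x.\<close>

definition pot_bound :: "real \<times> real \<Rightarrow> real" where
  "pot_bound x = 2 * ln (1 + norm x) * (\<integral>y. \<bar>f y\<bar> \<partial>lborel) + pi + 2 * pi"

lemma
  shows integrable_pot: "integrable lborel (\<lambda>y. ln (norm (x - y) / norm y) * f y)"
    and integral_abs_pot: "(\<integral>y. norm (ln (norm (x - y) / norm y) * f y) \<partial>lborel) \<le> pot_bound x"
proof -
  let ?d = "1 / (1 + norm x)"
  let ?h = "\<lambda>z. indicator (ball 0 ?d) z / norm z"
  let ?B = "\<lambda>y. 2 * ln (1 + norm x) * \<bar>f y\<bar> + indicator (ball 0 1) y + (1 + norm x) * ?h (- x + y)"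
  have d: "?d \<ge> 0" by simp
  have ih: "integrable lborel (\<lambda>y. ?h (- x + y))" "(\<integral>y. ?h (- x + y) \<partial>lborel) = 2 * pi * ?d"
    using lborel_integrable_translate[of ?h "- x"] lborel_integral_translate[of ?h "- x"]
      integrable_inverse_norm_ball[OF d] integral_inverse_norm_ball[OF d] by auto
  have ib: "integrable lborel (indicator (ball (0::real \<times> real) 1) :: _ \<Rightarrow> real)"
    by (intro integrable_real_indicator emeasure_lborel_ball_finite) simp
  have vol: "measure lborel (ball (0::real \<times> real) 1) = pi"
    by (simp add: content_ball unit_ball_vol_2)
  have "(1 + norm x) * (2 * pi * ?d) = 2 * pi"
    using norm_ge_zero[of x] by (simp add: field_simps add_nonneg_eq_0_iff)
  note m = this
  have i1: "integrable lborel (\<lambda>y. 2 * ln (1 + norm x) * \<bar>f y\<bar>)"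
    and i3: "integrable lborel (\<lambda>y. (1 + norm x) * ?h (- x + y))"
    by (intro integrable_mult_right integrable_abs int_f ih)+
  have iB1: "integrable lborel ?B" by (intro Bochner_Integration.integrable_add i1 ib i3)
  have iB2: "(\<integral>y. ?B y \<partial>lborel) = pot_bound x"
    unfolding Bochner_Integration.integral_add[OF Bochner_Integration.integrable_add[OF i1 ib] i3]
      Bochner_Integration.integral_add[OF i1 ib] integral_mult_right_zero ih(2) m
    by (simp add: pot_bound_def vol)
  note iB = iB1 iB2
  have le: "norm (ln (norm (x - y) / norm y) * f y) \<le> ?B y" for y
    using log_ratio_bound[of "\<bar>f y\<bar>" y x] f_le[of y] by (simp add: abs_mult)
  show i: "integrable lborel (\<lambda>y. ln (norm (x - y) / norm y) * f y)"
  proof (rule Bochner_Integration.integrable_bound[OF iB(1)])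
    show "AE y in lborel. norm (ln (norm (x - y) / norm y) * f y) \<le> norm (?B y)"
    proof (rule AE_I2)
      fix y show "norm (ln (norm (x - y) / norm y) * f y) \<le> norm (?B y)"
        using le[of y] unfolding real_norm_def[of "?B y"] by (rule order_trans) (rule abs_ge_self)
    qed
  qed measurable
  have "(\<integral>y. norm (ln (norm (x - y) / norm y) * f y) \<partial>lborel) \<le> (\<integral>y. ?B y \<partial>lborel)"
    by (rule integral_mono[OF integrable_norm[OF i] iB(1) le])
  then show "(\<integral>y. norm (ln (norm (x - y) / norm y) * f y) \<partial>lborel) \<le> pot_bound x" by (simp only: iB(2))
qed

lemma pot_bound_mono: "norm x \<le> norm y \<Longrightarrow> pot_bound x \<le> pot_bound y"
  unfolding pot_bound_def by (intro add_mono mult_right_mono mult_left_mono) (auto simp: add_pos_nonneg)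

lemma abs_pot_le: "\<bar>pot x\<bar> \<le> pot_bound x"
proof -
  have "\<bar>pot x\<bar> \<le> (\<integral>y. norm (ln (norm (x - y) / norm y) * f y) \<partial>lborel)"
    using integral_norm_bound unfolding pot_def real_norm_def[symmetric] by blast
  then show ?thesis using integral_abs_pot[of x] by linarith
qed

lemma integrable_pot_pair:
  "integrable (lborel \<Otimes>\<^sub>M lborel) (\<lambda>(z, y). indicator (ball 0 R) z * (ln (norm (a + z - y) / norm y) * f y))"
  (is "integrable _ ?g")
proof (rule lborel_pair.Fubini_integrable)
  show m: "?g \<in> borel_measurable (lborel \<Otimes>\<^sub>M lborel)" by measurable
  \<comment> \<open>\<open>pot_bound\<close> is monotone in the norm of its argument; the point
    \<open>(norm a + \<bar>R\<bar>, 0)\<close> merely has a norm that dominates |a + z| for all z in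
    the disc.\<close>
  have ib: "integrable lborel (\<lambda>z. indicator (ball (0::real \<times> real) R) z * pot_bound (norm a + \<bar>R\<bar>, 0))"
    by (intro integrable_mult_left integrable_real_indicator emeasure_lborel_ball_finite) simp
  show "integrable lborel (\<lambda>z. \<integral>y. norm (?g (z, y)) \<partial>lborel)"
  proof (rule Bochner_Integration.integrable_bound[OF ib])
    show "AE z in lborel. norm (\<integral>y. norm (?g (z, y)) \<partial>lborel) \<le>
      norm (indicator (ball (0::real \<times> real) R) z * pot_bound (norm a + \<bar>R\<bar>, 0))"
    proof (rule AE_I2)
      fix z :: "real \<times> real"
      show "norm (\<integral>y. norm (?g (z, y)) \<partial>lborel) \<le> norm (indicator (ball (0::real \<times> real) R) z * pot_bound (norm a + \<bar>R\<bar>, 0))"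
      proof (cases "z \<in> ball 0 R")
        case True
        then have "norm (a + z) \<le> norm (norm a + \<bar>R\<bar>, 0::real)"
          using norm_triangle_ineq[of a z] by (simp add: norm_prod_def)
        then have "pot_bound (a + z) \<le> pot_bound (norm a + \<bar>R\<bar>, 0)" by (rule pot_bound_mono)
        then have J: "(\<integral>y. norm (ln (norm (a + z - y) / norm y) * f y) \<partial>lborel) \<le> pot_bound (norm a + \<bar>R\<bar>, 0)"
          using integral_abs_pot[of "a + z"] by linarith
        moreover have J0: "(\<integral>y. norm (ln (norm (a + z - y) / norm y) * f y) \<partial>lborel) \<ge> 0" by simp
        ultimately have "pot_bound (norm a + \<bar>R\<bar>, 0) \<ge> 0" by linarith
        with J J0 True show ?thesis by simp
      qed simp
    qed
    have "(\<lambda>z. \<integral>y. norm (?g (z, y)) \<partial>lborel) \<in> borel_measurable lborel"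
      by (rule lborel.borel_measurable_lebesgue_integral) (use m in simp)
    then show "(\<lambda>z. \<integral>y. norm (?g (z, y)) \<partial>lborel) \<in> borel_measurable lborel" .
  qed
  show "AE z in lborel. integrable lborel (\<lambda>y. ?g (z, y))"
    using integrable_pot by (intro AE_I2) (simp add: integrable_mult_right)
qed

lemma
  assumes R: "R > 0"
  shows integrable_pot_ball: "set_integrable lborel (ball 0 R) (\<lambda>z. pot (a + z))"
    and integral_pot_ball: "(\<integral>z\<in>ball 0 R. pot (a + z) \<partial>lborel) =
      pi * R\<^sup>2 * (pot a + (\<integral>z\<in>ball 0 R. jensen_kernel R (norm z) * f (a + z) \<partial>lborel))"
proof -
  let ?g = "\<lambda>(z, y). indicator (ball 0 R) z * (ln (norm (a + z - y) / norm y) * f y)"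
  note i = integrable_pot_pair[of R a]
  have e1: "(\<integral>y. ?g (z, y) \<partial>lborel) = indicator (ball 0 R) z * pot (a + z)" for z
    by (simp add: pot_def)
  show "set_integrable lborel (ball 0 R) (\<lambda>z. pot (a + z))"
    using lborel_pair.integrable_fst'[OF i] unfolding e1 by (simp add: set_integrable_def)
  let ?k = "\<lambda>y. indicator (ball 0 R) (- a + y) * (jensen_kernel R (norm (- a + y)) * f y)"
  \<comment> \<open>For fixed y, averaging over z turns ln |a + z - y| into ln |a - y| plus the
    kernel term. The points y = 0 and y = a are dropped as null sets, so that the logarithm of the
    quotient splits and the disc average formula applies.\<close>
  have e2: "AE y in lborel. (\<integral>z. ?g (z, y) \<partial>lborel) = pi * R\<^sup>2 * (ln (norm (a - y) / norm y) * f y + ?k y)"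
    using AE_lborel_neq[of 0] AE_lborel_neq[of a]
  proof eventually_elim
    case (elim y)
    have ii: "set_integrable lborel (ball 0 R) (\<lambda>z. ln (norm (z - (y - a))))"
      by (rule set_integrable_ln_norm)
    have ic: "set_integrable lborel (ball (0::real \<times> real) R) (\<lambda>z. ln (norm y))"
      unfolding set_integrable_def
      by (intro integrable_scaleR_left integrable_real_indicator emeasure_lborel_ball_finite) auto
    have vol: "measure lborel (ball (0::real \<times> real) R) = pi * R\<^sup>2"
      using R by (simp add: content_ball unit_ball_vol_2 power2_eq_square)
    have "(\<integral>z. ?g (z, y) \<partial>lborel) = (\<integral>z. f y * (indicator (ball 0 R) z * (ln (norm (z - (y - a))) - ln (norm y))) \<partial>lborel)"
    proof (rule integral_cong_AE)
      show "AE z in lborel. ?g (z, y) = f y * (indicator (ball 0 R) z * (ln (norm (z - (y - a))) - ln (norm y)))"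
        using AE_lborel_neq[of "y - a"]
      proof eventually_elim
        case (elim z)
        then have p: "norm (z - (y - a)) > 0" "norm y > 0" using \<open>y \<noteq> 0\<close> by auto
        have e: "a + z - y = z - (y - a)" by simp
        have "ln (norm (a + z - y) / norm y) = ln (norm (z - (y - a))) - ln (norm y)"
          unfolding e by (rule ln_divide_pos[OF p])
        then show ?case by simp
      qed
      have "(\<lambda>z. indicator (ball 0 R) z * (ln (norm (z - (y - a))) - ln (norm y))) \<in> borel_measurable lborel"
        by measurable
      then show "(\<lambda>z. f y * (indicator (ball 0 R) z * (ln (norm (z - (y - a))) - ln (norm y)))) \<in> borel_measurable lborel"
        by (rule borel_measurable_times[OF borel_measurable_const])
    qed simp
    also have "\<dots> = f y * (\<integral>z\<in>ball 0 R. ln (norm (z - (y - a))) - ln (norm y) \<partial>lborel)"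
      by (simp add: set_lebesgue_integral_def)
    also have "(\<integral>z\<in>ball 0 R. ln (norm (z - (y - a))) - ln (norm y) \<partial>lborel) =
        pi * R\<^sup>2 * log_mean R (norm (y - a)) - pi * R\<^sup>2 * ln (norm y)"
      using elim R vol integral_ln_norm_ball[of R "y - a"] set_integral_diff(2)[OF ii ic]
      by (simp add: set_lebesgue_integral_def)
    also have "f y * \<dots> = pi * R\<^sup>2 * (ln (norm (a - y) / norm y) * f y + ?k y)"
    proof -
      have n: "norm (- a + y) = norm (y - a)" "norm (a - y) = norm (y - a)" by (simp_all add: norm_minus_commute)
      have "norm (y - a) > 0" "norm y > 0" using elim by auto
      then have l: "ln (norm (y - a) / norm y) = ln (norm (y - a)) - ln (norm y)" by (rule ln_divide_pos)
      show ?thesis unfolding n l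
        by (cases "norm (y - a) < R") (simp_all add: log_mean_eq n algebra_simps)
    qed
    finally show ?case .
  qed
  \<comment> \<open>The kernel term is integrable as a difference: Fubini's theorem covers the whole
    averaged integrand, and the potential's integrand is subtracted.\<close>
  have ik: "integrable lborel ?k"
  proof -
    have "integrable lborel (\<lambda>y. \<integral>z. ?g (z, y) \<partial>lborel)" using lborel_pair.integrable_snd[OF i] by simp
    moreover have "(\<lambda>y. pi * R\<^sup>2 * (ln (norm (a - y) / norm y) * f y + ?k y)) \<in> borel_measurable lborel"
      unfolding jensen_kernel_def by measurable
    ultimately have "integrable lborel (\<lambda>y. pi * R\<^sup>2 * (ln (norm (a - y) / norm y) * f y + ?k y))"
      using e2 integrable_cong_AE by blast
    then have "integrable lborel (\<lambda>y. ln (norm (a - y) / norm y) * f y + ?k y)"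
      using R by simp
    from Bochner_Integration.integrable_diff[OF this integrable_pot[of a]] show ?thesis by simp
  qed
  have "(\<integral>z\<in>ball 0 R. pot (a + z) \<partial>lborel) = (\<integral>z. \<integral>y. ?g (z, y) \<partial>lborel \<partial>lborel)"
    unfolding e1 by (simp add: set_lebesgue_integral_def)
  also have "\<dots> = (\<integral>y. \<integral>z. ?g (z, y) \<partial>lborel \<partial>lborel)"
    using lborel_pair.Fubini_integral[OF i] by simp
  also have "\<dots> = (\<integral>y. pi * R\<^sup>2 * (ln (norm (a - y) / norm y) * f y + ?k y) \<partial>lborel)"
    using e2 by (intro integral_cong_AE) (auto simp: jensen_kernel_def)
  also have "\<dots> = pi * R\<^sup>2 * (pot a + (\<integral>y. ?k y \<partial>lborel))"
    using ik integrable_pot[of a] by (simp add: pot_def)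
  also have "(\<integral>y. ?k y \<partial>lborel) = (\<integral>z. ?k (a + z) \<partial>lborel)"
    by (rule lborel_integral_translate[symmetric])
  also have "\<dots> = (\<integral>z\<in>ball 0 R. jensen_kernel R (norm z) * f (a + z) \<partial>lborel)"
    by (simp add: set_lebesgue_integral_def)
  finally show "(\<integral>z\<in>ball 0 R. pot (a + z) \<partial>lborel) =
      pi * R\<^sup>2 * (pot a + (\<integral>z\<in>ball 0 R. jensen_kernel R (norm z) * f (a + z) \<partial>lborel))" .
qed

end

section \<open>Liouville's theorem\<close>

text \<open>Only an upper bound on h is needed: with M an upper bound of h on the larger ball, M - h is
nonnegative there, so its integral over the smaller ball is at most the one over the larger ball.\<close>

lemma mean_value_liouville:
  fixes h :: "real \<times> real \<Rightarrow> real"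
  assumes int: "\<And>a R. R > 0 \<Longrightarrow> set_integrable lborel (ball 0 R) (\<lambda>z. h (a + z))"
    and mean: "\<And>a R. R > 0 \<Longrightarrow> (\<integral>z\<in>ball 0 R. h (a + z) \<partial>lborel) = pi * R\<^sup>2 * h a"
    and bound: "\<And>x. h x \<le> C * ln (1 + norm x) + D" and C: "C \<ge> 0"
  shows "h p = h q"
proof -
  have le: "h q \<le> h p" for p q
  proof -
    define d where "d = dist p q"
    define e where "e = norm q + d"
    have de: "d \<ge> 0" "e \<ge> 0" by (auto simp: d_def e_def)
    \<comment> \<open>The right side is ((R + d)^2 - R^2) / R^2 times M - h q, expanded so that
      every occurrence of R tends to a limit by itself. The number e + R bounds the norm on the
      larger disc.\<close>
    have step: "h q - h p \<le> (2 * d + d * (d * (1 / R))) * (C * (ln (1 + e + R) / R) + (D - h q) * (1 / R))" if R: "R > 0" for R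
    proof -
      define M where "M = C * ln (1 + e + R) + D"
      have M: "h x \<le> M" if "x \<in> ball q (R + d)" for x
      proof -
        have "norm x \<le> norm q + (R + d)" using that norm_triangle_sub[of x q] by (auto simp: dist_norm norm_minus_commute)
        then have "ln (1 + norm x) \<le> ln (1 + e + R)" by (subst ln_le_cancel_iff) (auto simp: e_def add_pos_nonneg de add_nonneg_pos R)
        then have "C * ln (1 + norm x) \<le> C * ln (1 + e + R)" using C by (rule mult_left_mono)
        with bound[of x] show ?thesis by (simp add: M_def)
      qed
      let ?w = "\<lambda>a S x. indicator (ball a S) x * (M - h x)"
      have W: "integrable lborel (?w a S)" "(\<integral>x. ?w a S x \<partial>lborel) = pi * S\<^sup>2 * (M - h a)" if S: "S > 0" for a S
      proof -
        have ic: "set_integrable lborel (ball (0::real \<times> real) S) (\<lambda>z. M)"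
          unfolding set_integrable_def
          by (intro integrable_scaleR_left integrable_real_indicator emeasure_lborel_ball_finite) auto
        have vol: "measure lborel (ball (0::real \<times> real) S) = pi * S\<^sup>2"
          using S by (simp add: content_ball unit_ball_vol_2 power2_eq_square)
        have "set_integrable lborel (ball 0 S) (\<lambda>z. M - h (a + z))"
          by (rule set_integral_diff(1)[OF ic int[OF S]])
        moreover have "(\<integral>z\<in>ball 0 S. M - h (a + z) \<partial>lborel) = pi * S\<^sup>2 * (M - h a)"
          unfolding set_integral_diff(2)[OF ic int[OF S]] mean[OF S]
          using vol by (simp add: set_lebesgue_integral_def algebra_simps)
        moreover have "indicator (ball a S) (a + z) = (indicator (ball 0 S) z :: real)" for z
          by (simp add: indicator_def dist_norm)
        ultimately show "integrable lborel (?w a S)" "(\<integral>x. ?w a S x \<partial>lborel) = pi * S\<^sup>2 * (M - h a)"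
          using lborel_integrable_translate[of "?w a S" a] lborel_integral_translate[of "?w a S" a]
          by (simp_all add: set_integrable_def set_lebesgue_integral_def)
      qed
      have Rd: "R + d > 0" using R de by linarith
      have sub: "x \<in> ball q (R + d)" if "x \<in> ball p R" for x
        using that dist_triangle[of q x p] by (auto simp: d_def dist_commute)
      have "pi * R\<^sup>2 * (M - h p) \<le> pi * (R + d)\<^sup>2 * (M - h q)"
        unfolding W(2)[OF R, symmetric] W(2)[OF Rd, symmetric]
      proof (rule integral_mono[OF W(1)[OF R] W(1)[OF Rd]])
        fix x show "?w p R x \<le> ?w q (R + d) x"
          using sub[of x] M[of x] by (auto simp: indicator_def)
      qed
      then have "R\<^sup>2 * (M - h p) \<le> (R + d)\<^sup>2 * (M - h q)"
        by (simp add: mult.assoc)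
      then have "R\<^sup>2 * (h q - h p) \<le> (2 * d * R + d * d) * (M - h q)"
        by (simp add: power2_eq_square algebra_simps)
      then have "h q - h p \<le> (2 * d * R + d * d) * (M - h q) / R\<^sup>2"
        using R by (simp add: pos_le_divide_eq mult.commute)
      also have "\<dots> = (2 * d + d * (d * (1 / R))) * (C * (ln (1 + e + R) / R) + (D - h q) * (1 / R))"
        using R by (simp add: M_def field_simps power2_eq_square)
      finally show ?thesis .
    qed
    have "((\<lambda>R::real. (2 * d + d * (d * (1 / R))) * (C * (ln (1 + e + R) / R) + (D - h q) * (1 / R)))
      \<longlongrightarrow> (2 * d + d * (d * 0)) * (C * 0 + (D - h q) * 0)) at_top"
    proof (intro tendsto_intros)
      show 1: "((\<lambda>R::real. 1 / R) \<longlongrightarrow> 0) at_top" by real_asymp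
      show "((\<lambda>R. ln (1 + e + R) / R) \<longlongrightarrow> 0) at_top" by real_asymp
      show "((\<lambda>R::real. 1 / R) \<longlongrightarrow> 0) at_top" by (rule 1)
    qed
    then have "((\<lambda>R::real. (2 * d + d * (d * (1 / R))) * (C * (ln (1 + e + R) / R) + (D - h q) * (1 / R))) \<longlongrightarrow> 0) at_top"
      by simp
    then have "h q - h p \<le> 0"
    proof (rule tendsto_lowerbound)
      show "\<forall>\<^sub>F R in at_top. h q - h p \<le> (2 * d + d * (d * (1 / R))) * (C * (ln (1 + e + R) / R) + (D - h q) * (1 / R))"
        using eventually_gt_at_top[of 0] by eventually_elim (rule step)
    qed simp
    then show ?thesis by simp
  qed
  from le[of p q] le[of q p] show ?thesis by simp
qed

section \<open>Application to u + v\<close>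

theorem theorem6:
  fixes u :: "real \<times> real \<Rightarrow> real"
  assumes "smooth2 u"
    and "\<And>x. - laplacian u x = fst x * exp (u x)"
    and "\<And>x. u x \<le> u (0, 0)" and "u (0, 0) = 0"
    and "integrable lborel (\<lambda>x. \<bar>fst x\<bar> * exp (u x))"
    and "(\<integral>x. fst x * exp (u x) \<partial>lborel) > 0"
  shows "\<exists>c. \<forall>x. u x + vfun u x = c"
proof -
  define f where "f y = fst y * exp (u y)" for y
  have u0: "u x \<le> 0" for x using assms(3)[of x] assms(4) by simp
  have "continuous_on UNIV u" using smooth2_continuous[OF assms(1), of "[]"] by simp
  then have [measurable]: "u \<in> borel_measurable borel" by (rule borel_measurable_continuous_onI)
  have [measurable]: "(fst :: real \<times> real \<Rightarrow> real) \<in> borel_measurable borel"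
    by (intro borel_measurable_continuous_onI continuous_intros)
  \<comment> \<open>One criterion for all three densities: domination by |x1| exp u gives
    integrability, and exp u \<le> 1 gives the linear bound.\<close>
  have dom: "log_potential g" if [measurable]: "g \<in> borel_measurable borel" and g: "\<And>y. \<bar>g y\<bar> \<le> \<bar>fst y\<bar> * exp (u y)" for g
  proof
    show "integrable lborel g"
      by (rule Bochner_Integration.integrable_bound[OF assms(5)]) (use g in auto)
    show "\<bar>g y\<bar> \<le> norm y" for y
    proof -
      have "\<bar>fst y\<bar> * exp (u y) \<le> \<bar>fst y\<bar> * 1" using u0[of y] by (intro mult_left_mono) auto
      also have "\<dots> \<le> norm y" using norm_fst_le[of "fst y" "snd y"] by simp
      finally show ?thesis using g[of y] by linarith
    qed
  qed
  have [measurable]: "f \<in> borel_measurable borel"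
    unfolding f_def[abs_def] by measurable
  interpret P: log_potential f
    by (rule dom) (auto simp: f_def abs_mult)
  interpret Pp: log_potential "\<lambda>y. Kp y * exp (u y)"
    by (rule dom) (auto simp: Kp_def abs_mult)
  interpret Pm: log_potential "\<lambda>y. Km y * exp (u y)"
    by (rule dom) (auto simp: Km_def abs_mult)
  have v: "vfun u x = 1 / (2 * pi) * P.pot x" for x
  proof -
    \<comment> \<open>The positive and negative parts have separately convergent potentials, so
      their difference is the potential of the signed density.\<close>
    have "P.pot x = Pp.pot x - Pm.pot x"
      unfolding P.pot_def Pp.pot_def Pm.pot_def
      by (subst Bochner_Integration.integral_diff[OF Pp.integrable_pot Pm.integrable_pot, symmetric],
        intro Bochner_Integration.integral_cong)
        (auto simp: f_def Kp_def Km_def max_def algebra_simps)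
    then show ?thesis
      by (simp add: vfun_def v0_def v1_def Pp.pot_def Pm.pot_def mult.assoc right_diff_distrib)
  qed
  define F where "F = (\<integral>y. \<bar>f y\<bar> \<partial>lborel)"
  have F0: "F \<ge> 0" by (simp add: F_def)
  define h where "h x = u x + 1 / (2 * pi) * P.pot x" for x
  have lap: "laplacian u x = - f x" for x using assms(2)[of x] by (simp add: f_def)
  have ball: "set_integrable lborel (ball 0 R) (\<lambda>z. h (a + z))"
    "(\<integral>z\<in>ball 0 R. h (a + z) \<partial>lborel) = pi * R\<^sup>2 * h a" if R: "R > 0" for a R
  proof -
    interpret S: smooth_function u a by standard (rule assms(1))
    note iu = S.jensen_formula(2)[OF R]
    note ip = set_integrable_mult_right[OF P.integrable_pot_ball[OF R, of a], of "1 / (2 * pi)"]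
    let ?k = "\<integral>z\<in>ball 0 R. jensen_kernel R (norm z) * f (a + z) \<partial>lborel"
    have "(\<integral>z\<in>ball 0 R. jensen_kernel R (norm z) * laplacian u (a + z) \<partial>lborel) = - ?k"
      by (simp add: lap set_lebesgue_integral_def)
    \<comment> \<open>Since the Laplacian of u is -f, the disc integral of u falls short of its mean
      value by R^2 / 2 times \<open>?k\<close>. The potential exceeds its own by pi R^2
      \<open>?k\<close>, and the factor 1 / (2 pi) makes the two match.\<close>
    with S.jensen_formula(3)[OF R] have U: "(\<integral>z\<in>ball 0 R. u (a + z) \<partial>lborel) = pi * R\<^sup>2 * u a - R\<^sup>2 / 2 * ?k"
      using R by (simp add: field_simps)
    show "set_integrable lborel (ball 0 R) (\<lambda>z. h (a + z))"
      unfolding h_def by (intro set_integral_add(1) iu ip)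
    have "(\<integral>z\<in>ball 0 R. h (a + z) \<partial>lborel) =
        (\<integral>z\<in>ball 0 R. u (a + z) \<partial>lborel) + 1 / (2 * pi) * (\<integral>z\<in>ball 0 R. P.pot (a + z) \<partial>lborel)"
      unfolding h_def using set_integral_add(2)[OF iu ip] by simp
    then show "(\<integral>z\<in>ball 0 R. h (a + z) \<partial>lborel) = pi * R\<^sup>2 * h a"
      unfolding U P.integral_pot_ball[OF R] h_def by (simp add: field_simps)
  qed
  \<comment> \<open>Because u is bounded only from above, the estimate is one-sided. The constant 3
    / 2 is (pi + 2 pi) / (2 pi), from the constant part of \<open>pot_bound\<close>.\<close>
  have hb: "h x \<le> F / pi * ln (1 + norm x) + 3 / 2" for x
  proof -
    have "P.pot x \<le> 2 * ln (1 + norm x) * F + 3 * pi"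
      using P.abs_pot_le[of x] unfolding P.pot_bound_def F_def[symmetric] by linarith
    then have "1 / (2 * pi) * P.pot x \<le> 1 / (2 * pi) * (2 * ln (1 + norm x) * F + 3 * pi)"
      by (intro mult_left_mono) auto
    also have "\<dots> = F / pi * ln (1 + norm x) + 3 / 2" by (simp add: field_simps)
    finally show ?thesis using u0[of x] by (simp add: h_def)
  qed
  have "h x = h 0" for x
    by (rule mean_value_liouville[OF ball hb]) (use F0 in auto)
  then show ?thesis by (auto simp: v h_def)
qed

end
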